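(* Every oriented percolation Markov decision process (PMDP) on $\mathbb{Z}^d$ admits a stationary 0-optimal strategy; that is, there exists a stationary strategy $\sigma\in\Sigma$ such that, for every initial state $z\in\mathbb{Z}^d$, $\gamma_n(z,\sigma)\to v_\infty$ as $n\to\infty$, $\mathbb{P}$-a.s., where $v_\infty$ is the limit value.
   Context: A PMDP on $\mathbb{Z}^d$ is a tuple $(I,\mathcal{E},g)$ where $I\subset\mathbb{Z}^d$ is a non-empty finite set (the action set), $\mathcal{E}=(\Omega,\mathscr{F},\mathbb{P})$ is a probability space, and $g=\{\omega\mapsto g_\omega(z,i)\}_{(z,i)\in\mathbb{Z}^d\times I}$ is a collection of uniformly bounded, i.i.d. real-valued random variables on $\Omega$. It is oriented if $0\notin\operatorname{conv}(I)$. Let $\mathcal{F}_{\mathrm{all}}=\sigma(\{\omega\mapsto g_\omega(z,i): z\in\mathbb{Z}^d,i\in I\})$. A strategy is a sequence $\sigma=(\sigma_m)_{m\ge1}$ of mappings $\sigma_m:\Omega\times\mathbb{Z}^d\to I$, each measurable with respect to $\mathcal{F}_{\mathrm{all}}\otimes\mathcal{P}(\mathbb{Z}^d)$; $\Sigma$ is the set of strategies. Given an initial state $z$ and $\omega$, $\sigma$ induces the play $z_1=z$, $i_m=\sigma_m(\omega,z)$, $z_{m+1}=z_m+i_m$ for $m\ge1$. The $n$-stage payoff is $\gamma_n^\omega(z,\sigma)=\frac1n\sum_{m=1}^n g_\omega(z_m,i_m)$ and the $n$-stage value is $v_n^\omega(z)=\max_{\sigma\in\Sigma}\gamma_n^\omega(z,\sigma)$;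 $\gamma_n(z,\sigma)$ and $v_n(z)$ denote the corresponding random variables. For an oriented PMDP it is known (Garnier–Ziliotto) that $v_n(z)$ converges $\mathbb{P}$-a.s. to a deterministic constant $v_\infty\in\mathbb{R}$ independent of $z$, called the limit value. A strategy $\sigma=(\sigma_m)_{m\ge1}\in\Sigma$ is stationary if there is a mapping $\sigma^*:\Omega\times\mathbb{Z}^d\to I$ such that for all $m\ge1$, $\sigma_m(\omega,z)=\sigma^*(\omega,z_m)$, where $z_m$ is the state at stage $m$ induced by $\sigma$ starting from $z$. *)

theory Defs
  imports "HOL-Probability.Probability"
begin

locale pmdp = prob_space M for M :: "'w measure" +
  fixes I :: "(int ^ 'd) set" and g :: "'w \<Rightarrow> int ^ 'd \<Rightarrow> int ^ 'd \<Rightarrow> real"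
  assumes I_finite: "finite I"
    and I_nonempty: "I \<noteq> {}"
    and g_bounded: "\<exists>C. \<forall>\<omega>\<in>space M. \<forall>z. \<forall>i\<in>I. \<bar>g \<omega> z i\<bar> \<le> C"
    and g_indep: "indep_vars (\<lambda>_. borel) (\<lambda>(z, i) \<omega>. g \<omega> z i) (UNIV \<times> I)"
    and g_ident_distr: "\<And>z i z' i'. i \<in> I \<Longrightarrow> i' \<in> I \<Longrightarrow>
          distr M borel (\<lambda>\<omega>. g \<omega> z i) = distr M borel (\<lambda>\<omega>. g \<omega> z' i')"

definition vec_of_int :: "int ^ 'd \<Rightarrow> real ^ 'd" where
  "vec_of_int z = (\<chi> k. of_int (z $ k))"

locale oriented_pmdp = pmdp M I g
  for M :: "'w measure" and I :: "(int ^ 'd) set" and g :: "'w \<Rightarrow> int ^ 'd \<Rightarrow> int ^ 'd \<Rightarrow> real" +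
  assumes oriented: "0 \<notin> convex hull (vec_of_int ` I)"

definition F_all ::
  "'w measure \<Rightarrow> (int ^ 'd) set \<Rightarrow> ('w \<Rightarrow> int ^ 'd \<Rightarrow> int ^ 'd \<Rightarrow> real) \<Rightarrow> 'w measure" where
  "F_all M I g =
     sigma (space M) {(\<lambda>\<omega>. g \<omega> z i) -` B \<inter> space M | z i B. i \<in> I \<and> B \<in> sets borel}"

text \<open>Stages are numbered from 1; the value of a strategy at index 0 is irrelevant throughout.\<close>

definition strategies ::
  "'w measure \<Rightarrow> (int ^ 'd) set \<Rightarrow> ('w \<Rightarrow> int ^ 'd \<Rightarrow> int ^ 'd \<Rightarrow> real)
    \<Rightarrow> (nat \<Rightarrow> 'w \<Rightarrow> int ^ 'd \<Rightarrow> int ^ 'd) set" where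
  "strategies M I g =
     {\<sigma>. \<forall>m\<ge>1. (\<lambda>(\<omega>, z). \<sigma> m \<omega> z) \<in> F_all M I g \<Otimes>\<^sub>M count_space UNIV \<rightarrow>\<^sub>M count_space I}"

text \<open>A strategy reads the initial state \<open>z\<close>, not the current one: the action at stage \<open>m\<close> is
  \<open>\<sigma> m \<omega> z\<close>. The state at stage \<open>m\<close> is \<open>state_at \<sigma> \<omega> z m\<close> for \<open>m \<ge> 1\<close>; index 0 is a dummy.\<close>

primrec state_at ::
  "(nat \<Rightarrow> 'w \<Rightarrow> int ^ 'd \<Rightarrow> int ^ 'd) \<Rightarrow> 'w \<Rightarrow> int ^ 'd \<Rightarrow> nat \<Rightarrow> int ^ 'd" where
  "state_at \<sigma> \<omega> z 0 = z"
| "state_at \<sigma> \<omega> z (Suc m) = (if m = 0 then z else state_at \<sigma> \<omega> z m + \<sigma> m \<omega> z)"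

definition payoff ::
  "('w \<Rightarrow> int ^ 'd \<Rightarrow> int ^ 'd \<Rightarrow> real) \<Rightarrow> nat \<Rightarrow> 'w \<Rightarrow> int ^ 'd
    \<Rightarrow> (nat \<Rightarrow> 'w \<Rightarrow> int ^ 'd \<Rightarrow> int ^ 'd) \<Rightarrow> real" where
  "payoff g n \<omega> z \<sigma> = (1 / real n) * (\<Sum>m=1..n. g \<omega> (state_at \<sigma> \<omega> z m) (\<sigma> m \<omega> z))"

definition stage_value ::
  "'w measure \<Rightarrow> (int ^ 'd) set \<Rightarrow> ('w \<Rightarrow> int ^ 'd \<Rightarrow> int ^ 'd \<Rightarrow> real)
    \<Rightarrow> nat \<Rightarrow> 'w \<Rightarrow> int ^ 'd \<Rightarrow> real" where
  "stage_value M I g n \<omega> z = Max (payoff g n \<omega> z ` strategies M I g)"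

text \<open>The deterministic almost sure limit of the values, the same for all initial states. It
  exists for every oriented PMDP by a theorem of Garnier and Ziliotto, and is unique because the
  underlying measure is a probability.\<close>

definition limit_value ::
  "'w measure \<Rightarrow> (int ^ 'd) set \<Rightarrow> ('w \<Rightarrow> int ^ 'd \<Rightarrow> int ^ 'd \<Rightarrow> real) \<Rightarrow> real" where
  "limit_value M I g =
     (THE v. \<forall>z. AE \<omega> in M. (\<lambda>n. stage_value M I g n \<omega> z) \<longlonglongrightarrow> v)"

definition stationary ::
  "'w measure \<Rightarrow> (int ^ 'd) set \<Rightarrow> (nat \<Rightarrow> 'w \<Rightarrow> int ^ 'd \<Rightarrow> int ^ 'd) \<Rightarrow> bool" where
  "stationary M I \<sigma> \<longleftrightarrow>
     (\<exists>\<sigma>'. (\<forall>\<omega>\<in>space M. \<forall>z. \<sigma>' \<omega> z \<in> I) \<and>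
       (\<forall>m\<ge>1. \<forall>\<omega>\<in>space M. \<forall>z. \<sigma> m \<omega> z = \<sigma>' \<omega> (state_at \<sigma> \<omega> z m)))"

text \<open>The maximum defining \<^const>\<open>stage_value\<close> is over a finite non-empty set: for fixed \<open>\<omega>\<close> and
  \<open>z\<close> the payoff only depends on the first \<open>n\<close> actions.\<close>

lemma strategy_action:
  assumes "\<sigma> \<in> strategies M I g" "m \<ge> 1" "\<omega> \<in> space M"
  shows "\<sigma> m \<omega> z \<in> I"
proof -
  have "(\<lambda>(\<omega>, z). \<sigma> m \<omega> z) \<in> F_all M I g \<Otimes>\<^sub>M count_space UNIV \<rightarrow>\<^sub>M count_space I"
    using assms by (auto simp: strategies_def)
  from measurable_space[OF this, of "(\<omega>, z)"] assms(3) show ?thesis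
    by (simp add: space_pair_measure F_all_def space_measure_of_conv)
qed

lemma state_at_cong:
  assumes "\<And>k. 1 \<le> k \<Longrightarrow> k < m \<Longrightarrow> \<sigma> k \<omega> z = \<tau> k \<omega> z"
  shows "state_at \<sigma> \<omega> z m = state_at \<tau> \<omega> z m"
  using assms by (induction m) auto

lemma (in pmdp) strategies_nonempty: "strategies M I g \<noteq> {}"
proof -
  obtain i where "i \<in> I" using I_nonempty by blast
  then have "(\<lambda>_ _ _. i) \<in> strategies M I g"
    by (auto simp: strategies_def)
  then show ?thesis by blast
qed

lemma (in pmdp) finite_payoffs:
  assumes "\<omega> \<in> space M"
  shows "finite (payoff g n \<omega> z ` strategies M I g)"
proof -
  define P where "P f = payoff g n \<omega> z (\<lambda>m _ _. f m)" for f
  have "payoff g n \<omega> z \<sigma> \<in> P ` ({1..n} \<rightarrow>\<^sub>E I)" if \<sigma>: "\<sigma> \<in> strategies M I g" for \<sigma>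
  proof -
    define f where "f = (\<lambda>m\<in>{1..n}. \<sigma> m \<omega> z)"
    have "f \<in> {1..n} \<rightarrow>\<^sub>E I"
      using strategy_action[OF \<sigma> _ assms] by (auto simp: f_def)
    moreover have "payoff g n \<omega> z \<sigma> = P f"
      unfolding P_def payoff_def
    proof (intro arg_cong2[where f = "(*)"] sum.cong refl)
      fix m assume m: "m \<in> {1..n}"
      have "state_at \<sigma> \<omega> z m = state_at (\<lambda>m _ _. f m) \<omega> z m"
        using m by (intro state_at_cong) (auto simp: f_def)
      then show "g \<omega> (state_at \<sigma> \<omega> z m) (\<sigma> m \<omega> z)
          = g \<omega> (state_at (\<lambda>m _ _. f m) \<omega> z m) (f m)"
        using m by (simp add: f_def)
    qed
    ultimately show ?thesis by blast
  qed
  then have "payoff g n \<omega> z ` strategies M I g \<subseteq> P ` ({1..n} \<rightarrow>\<^sub>E I)" by blast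
  moreover have "finite (P ` ({1..n} \<rightarrow>\<^sub>E I))"
    using I_finite by (intro finite_imageI finite_PiE) auto
  ultimately show ?thesis by (rule finite_subset)
qed

end

theory Submission
  imports Defs "HOL-Real_Asymp.Real_Asymp"
begin

text \<open>Separating \<open>0\<close> from the convex hull of the actions gives an integral linear height that
  increases at every step, so a path meets each level of the height at most once and changing the
  payoffs on one level moves the optimal \<open>n\<close>-stage total by a bounded amount. McDiarmid's argument
  over levels yields subgaussian concentration, uniformly over polynomially many starting points.
  Hence the mean optimal totals are additive up to \<open>O(n powr (3/4))\<close>, and almost surely the optimal
  \<open>m\<close>-stage total from every point of the cube of radius \<open>n\<^sup>2\<close> is \<open>m v + o(n)\<close> for all \<open>m \<le> n\<close>.
  This identifies \<open>v\<close> as the limit value.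

  The stationary strategy maximises, from the current state, the sum of \<open>g - v\<close> until the height
  leaves its dyadic band \<open>[2\<^sup>k, 2 * 2\<^sup>k)\<close>. By the uniform estimate this maximum is \<open>o(2\<^sup>k)\<close> in absolute
  value at every state visited late, so both the completed bands and the current partial band
  contribute only \<open>o(n)\<close> in total.\<close>

section \<open>Almost additive sequences and concentration\<close>

text \<open>The dyadic limits of \<open>a (2 ^ k * n) / 2 ^ k\<close> are additive in \<open>n\<close>, hence linear.\<close>

lemma near_additive_limit:
  fixes a :: "nat \<Rightarrow> real" and A :: real
  assumes a: "\<And>m n. \<bar>a (m + n) - a m - a n\<bar> \<le> A * real (m + n) powr (3/4)"
  shows "\<exists>v B. \<forall>n. \<bar>a n - real n * v\<bar> \<le> B * real n powr (3/4)"
proof -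
  \<comment> \<open>A defect of order \<open>x powr (3/4)\<close> at \<open>x = 2 ^ k * n\<close>,
    divided by \<open>2 ^ k\<close>, decays like \<open>r ^ k\<close>; any exponent below 1 would
    give such a ratio.\<close>
  define r :: real where "r = 2 powr (-1/4)"
  have r: "0 < r" "r < 1"
    by (auto simp: r_def powr_less_one)
  have r_pow: "((2::real) ^ k) powr (3/4) / 2 ^ k = r ^ k" for k
  proof -
    have "((2::real) ^ k) powr (3/4) / 2 ^ k = (2 powr real k) powr (3/4) / 2 powr real k"
      by (simp add: powr_realpow)
    also have "\<dots> = 2 powr (real k * (3/4) - real k)"
      by (subst powr_diff) (simp add: powr_powr)
    also have "\<dots> = (2 powr (-1/4)) powr real k"
      by (simp add: powr_powr)
    finally show ?thesis
      by (simp add: r_def powr_realpow)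
  qed
  define b where "b n k = a (2 ^ k * n) / 2 ^ k" for n k :: nat
  define S where "S n k = A * real n powr (3/4) * r ^ Suc k" for n k
  have A_nonneg: "0 \<le> A"
    using order_trans[OF abs_ge_zero a[of 1 0]] by simp
  have step: "\<bar>b n (Suc k) - b n k\<bar> \<le> S n k" for n k
  proof -
    have "b n (Suc k) - b n k = (a (2 ^ k * n + 2 ^ k * n) - a (2 ^ k * n) - a (2 ^ k * n)) / 2 ^ Suc k"
    proof -
      have "2 ^ Suc k * n = 2 ^ k * n + 2 ^ k * n" by simp
      moreover have "Y / 2 ^ Suc k - X / 2 ^ k = (Y - X - X) / 2 ^ Suc k" for X Y :: real
        by (simp add: field_simps)
      ultimately show ?thesis by (simp only: b_def)
    qed
    then have "\<bar>b n (Suc k) - b n k\<bar>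
        = \<bar>a (2 ^ k * n + 2 ^ k * n) - a (2 ^ k * n) - a (2 ^ k * n)\<bar> / 2 ^ Suc k"
      by simp
    also have "\<dots> \<le> A * real (2 ^ k * n + 2 ^ k * n) powr (3/4) / 2 ^ Suc k"
      by (intro divide_right_mono a) simp
    also have "real (2 ^ k * n + 2 ^ k * n) powr (3/4) = (2 ^ Suc k) powr (3/4) * real n powr (3/4)"
      by (subst powr_mult[symmetric]) (auto simp: algebra_simps)
    also have "A * ((2 ^ Suc k) powr (3/4) * real n powr (3/4)) / 2 ^ Suc k = S n k"
      unfolding S_def r_pow[symmetric] by simp
    finally show ?thesis .
  qed
  have sumS: "summable (S n)" for n
    unfolding S_def using r by (intro summable_mult) (auto simp: summable_geometric)
  have sum_abs: "summable (\<lambda>k. \<bar>b n (Suc k) - b n k\<bar>)" for n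
    by (rule summable_comparison_test'[OF sumS[of n], of 0])
      (simp only: real_norm_def abs_idempotent, rule step)
  have sum_b: "summable (\<lambda>k. b n (Suc k) - b n k)" for n
    by (rule summable_rabs_cancel[OF sum_abs])
  define f where "f n = b n 0 + (\<Sum>k. b n (Suc k) - b n k)" for n
  have lim: "b n \<longlonglongrightarrow> f n" for n
  proof -
    have "(\<lambda>N. b n 0 + (\<Sum>k<N. b n (Suc k) - b n k)) \<longlonglongrightarrow> f n"
      unfolding f_def by (intro tendsto_add tendsto_const summable_LIMSEQ sum_b)
    then show ?thesis
      by (simp add: sum_lessThan_telescope)
  qed
  \<comment> \<open>\<open>b n 0 = a n\<close>, so the distance to the limit is the whole
    telescoping series.\<close>
  have bound: "\<bar>a n - f n\<bar> \<le> A * (\<Sum>k. r ^ Suc k) * real n powr (3/4)" for n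
  proof -
    have "\<bar>a n - f n\<bar> = \<bar>\<Sum>k. b n (Suc k) - b n k\<bar>"
      by (simp add: f_def b_def)
    also have "\<dots> \<le> (\<Sum>k. \<bar>b n (Suc k) - b n k\<bar>)"
      by (rule summable_rabs[OF sum_abs])
    also have "\<dots> \<le> (\<Sum>k. S n k)"
      by (rule suminf_le[OF step sum_abs sumS])
    also have "\<dots> = A * real n powr (3/4) * (\<Sum>k. r ^ Suc k)"
      unfolding S_def using r
      by (intro suminf_mult) (simp add: summable_geometric summable_mult)
    finally show ?thesis
      by (simp add: algebra_simps)
  qed
  have add: "f (m + n) = f m + f n" for m n
  proof -
    have "(\<lambda>k. b (m + n) k - b m k - b n k) \<longlonglongrightarrow> f (m + n) - f m - f n"
      by (intro tendsto_diff lim)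
    moreover have "(\<lambda>k. b (m + n) k - b m k - b n k) \<longlonglongrightarrow> 0"
    proof (rule Lim_null_comparison[OF always_eventually])
      show "\<forall>k. norm (b (m + n) k - b m k - b n k) \<le> A * real (m + n) powr (3/4) * r ^ k"
      proof
        fix k
        have "norm (b (m + n) k - b m k - b n k)
          = \<bar>a (2 ^ k * m + 2 ^ k * n) - a (2 ^ k * m) - a (2 ^ k * n)\<bar> / 2 ^ k"
          by (simp add: b_def distrib_left flip: diff_divide_distrib)
        also have "\<dots> \<le> A * real (2 ^ k * m + 2 ^ k * n) powr (3/4) / 2 ^ k"
          by (intro divide_right_mono a) simp
        also have "real (2 ^ k * m + 2 ^ k * n) powr (3/4) = (2 ^ k) powr (3/4) * real (m + n) powr (3/4)"
          by (subst powr_mult[symmetric]) (auto simp: algebra_simps)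
        also have "A * ((2 ^ k) powr (3/4) * real (m + n) powr (3/4)) / 2 ^ k
          = A * real (m + n) powr (3/4) * r ^ k"
          unfolding r_pow[symmetric] by simp
        finally show "norm (b (m + n) k - b m k - b n k) \<le> A * real (m + n) powr (3/4) * r ^ k" .
      qed
      show "(\<lambda>k. A * real (m + n) powr (3/4) * r ^ k) \<longlonglongrightarrow> 0"
        using r by (intro tendsto_mult_right_zero LIMSEQ_power_zero) auto
    qed
    ultimately show ?thesis
      using LIMSEQ_unique by fastforce
  qed
  have lin: "f n = real n * f 1" for n
  proof (induction n)
    case 0
    show ?case using add[of 0 0] by simp
  next
    case (Suc n)
    then show ?case using add[of n 1] by (simp add: algebra_simps)
  qed
  have "\<bar>a n - real n * f 1\<bar> \<le> A * (\<Sum>k. r ^ Suc k) * real n powr (3/4)" for n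
    using bound[of n] unfolding lin[of n] .
  then show ?thesis by blast
qed

section \<open>Subgaussian concentration from bounded differences\<close>

text \<open>Bounded oscillation confines \<open>f\<close> to an interval of length
  \<open>2 * c\<close> around its value at one point, and Hoeffding's lemma with parameter 1 gives
  the exponent \<open>(2 * c)^2 / 8\<close>. Using a reference point instead of infimum and supremum
  costs a factor 4 there.\<close>

lemma (in prob_space) Hoeffdings_lemma_centered:
  fixes f :: "'a \<Rightarrow> real"
  assumes f [measurable]: "random_variable borel f"
    and c: "\<And>x y. x \<in> space M \<Longrightarrow> y \<in> space M \<Longrightarrow> \<bar>f x - f y\<bar> \<le> c"
  shows "expectation (\<lambda>x. exp (f x - expectation f)) \<le> exp (c\<^sup>2 / 2)"
proof -
  obtain x0 where x0: "x0 \<in> space M" using not_empty by blast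
  interpret X: interval_bounded_random_variable M f "f x0 - c" "f x0 + c"
  proof
    show "AE x in M. f x \<in> {f x0 - c..f x0 + c}"
      using c[OF _ x0] by (intro AE_I2) (auto simp: abs_le_iff algebra_simps)
  qed measurable
  have "(\<integral>\<^sup>+ x. exp (1 * (f x - expectation f)) \<partial>M) \<le> exp (1\<^sup>2 * (f x0 + c - (f x0 - c))\<^sup>2 / 8)"
    by (rule X.Hoeffdings_lemma_nn_integral) simp
  then have nn: "(\<integral>\<^sup>+ x. exp (f x - expectation f) \<partial>M) \<le> exp (c\<^sup>2 / 2)"
    by (simp add: power2_eq_square)
  have "expectation (\<lambda>x. exp (f x - expectation f)) = enn2real (\<integral>\<^sup>+ x. exp (f x - expectation f) \<partial>M)"
    by (intro integral_eq_nn_integral) auto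
  also have "\<dots> \<le> exp (c\<^sup>2 / 2)"
    using nn by (intro enn2real_leI) auto
  finally show ?thesis .
qed

text \<open>Dependence on whole blocks of coordinates (the fibres of \<open>lev\<close>) matters here: the
  bounded difference is per block, not per coordinate.\<close>

lemma bounded_difference_mgf:
  fixes D :: "'i \<Rightarrow> 'a measure" and lev :: "'i \<Rightarrow> 'k" and f :: "('i \<Rightarrow> 'a) \<Rightarrow> real"
  assumes D: "\<And>i. prob_space (D i)"
    and "finite L" "finite J" "lev ` J \<subseteq> L"
    and "f \<in> borel_measurable (PiM J D)"
    and "\<And>x. x \<in> space (PiM J D) \<Longrightarrow> \<bar>f x\<bar> \<le> b"
    and "\<And>x y k. x \<in> space (PiM J D) \<Longrightarrow> y \<in> space (PiM J D) \<Longrightarrow>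
          (\<And>j. j \<in> J \<Longrightarrow> lev j \<noteq> k \<Longrightarrow> x j = y j) \<Longrightarrow> \<bar>f x - f y\<bar> \<le> c"
  shows "(\<integral>x. exp (f x - (\<integral>y. f y \<partial>PiM J D)) \<partial>PiM J D) \<le> exp (c\<^sup>2 * real (card L) / 2)"
  using assms(2-)
proof (induction L arbitrary: J f rule: finite_induct)
  interpret product_prob_space D
    by (intro product_prob_spaceI D)
  case empty
  then have J: "J = {}" by simp
  interpret E: prob_space "PiM {} D" by (rule prob_space_PiM[OF D])
  have *: "f x = f (\<lambda>_. undefined)" if "x \<in> space (PiM {} D)" for x
    using that by (simp add: space_PiM_empty)
  have "(\<integral>y. f y \<partial>PiM {} D) = (\<integral>y. f (\<lambda>_. undefined) \<partial>PiM {} D)"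
    by (rule Bochner_Integration.integral_cong[OF refl *])
  then have "(\<integral>y. f y \<partial>PiM {} D) = f (\<lambda>_. undefined)"
    by (simp add: E.prob_space)
  then have "(\<integral>x. exp (f x - (\<integral>y. f y \<partial>PiM {} D)) \<partial>PiM {} D) = (\<integral>x. 1 \<partial>PiM {} D)"
    by (intro Bochner_Integration.integral_cong[OF refl]) (metis * diff_self exp_zero)
  then show ?case
    by (simp add: J E.prob_space)
next
  interpret product_prob_space D
    by (intro product_prob_spaceI D)
  case (insert k L)
  \<comment> \<open>The block of level \<open>k\<close> is integrated out first. The average
    \<open>F\<close> over it keeps the bound \<open>b\<close> and the differences \<open>c\<close>,
    so the induction hypothesis applies to \<open>F\<close>, and the block contributes one factor
    \<open>exp (c^2 / 2)\<close>.\<close>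
  define K where "K = {j\<in>J. lev j \<noteq> k}"
  define B where "B = {j\<in>J. lev j = k}"
  have J: "J = K \<union> B" "K \<inter> B = {}" "finite K" "finite B"
    using \<open>finite J\<close> by (auto simp: K_def B_def)
  have fM [measurable]: "f \<in> borel_measurable (PiM (K \<union> B) D)"
    using insert.prems(3) J by simp
  note bnd = insert.prems(4)[unfolded J(1)] and dif = insert.prems(5)[unfolded J(1)]
  interpret PK: prob_space "PiM K D" by (rule prob_space_PiM[OF D])
  interpret PB: prob_space "PiM B D" by (rule prob_space_PiM[OF D])
  interpret PJ: prob_space "PiM (K \<union> B) D" by (rule prob_space_PiM[OF D])
  have mg: "merge K B (x, y) \<in> space (PiM (K \<union> B) D)"
    if "x \<in> space (PiM K D)" "y \<in> space (PiM B D)" for x y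
    using measurable_space[OF measurable_merge, of "(x, y)" K D B] that
    by (simp add: space_pair_measure)
  define F where "F x = (\<integral>y. f (merge K B (x, y)) \<partial>PiM B D)" for x
  have mF [measurable]: "F \<in> borel_measurable (PiM K D)"
    unfolding F_def by measurable
  have sec [measurable]: "(\<lambda>y. f (merge K B (x, y))) \<in> borel_measurable (PiM B D)"
    if "x \<in> space (PiM K D)" for x
    using that by measurable
  have int_sec: "integrable (PiM B D) (\<lambda>y. f (merge K B (x, y)))" if "x \<in> space (PiM K D)" for x
    using that by (intro PB.integrable_const_bound[of _ b] AE_I2) (auto intro: bnd mg)
  have int_f: "integrable (PiM (K \<union> B) D) f"
    by (intro PJ.integrable_const_bound[of _ b] AE_I2) (auto intro: bnd)
  have bF: "\<bar>F x\<bar> \<le> b" if "x \<in> space (PiM K D)" for x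
  proof -
    have "\<bar>F x\<bar> \<le> (\<integral>y. \<bar>f (merge K B (x, y))\<bar> \<partial>PiM B D)"
      unfolding F_def by (rule integral_abs_bound)
    also have "\<dots> \<le> (\<integral>y. b \<partial>PiM B D)"
      using that by (intro integral_mono integrable_abs int_sec bnd mg) auto
    finally show ?thesis by (simp add: PB.prob_space)
  qed
  \<comment> \<open>Points of the smaller product that agree off level \<open>k'\<close> still do so
    after being merged with the same block \<open>w\<close>.\<close>
  have dF: "\<bar>F x - F y\<bar> \<le> c" if "x \<in> space (PiM K D)" "y \<in> space (PiM K D)"
     "\<And>j. j \<in> K \<Longrightarrow> lev j \<noteq> k' \<Longrightarrow> x j = y j" for x y k'
  proof -
    have "F x - F y = (\<integral>w. f (merge K B (x, w)) - f (merge K B (y, w)) \<partial>PiM B D)"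
      unfolding F_def using that by (intro Bochner_Integration.integral_diff[symmetric] int_sec)
    then have "\<bar>F x - F y\<bar> \<le> (\<integral>w. \<bar>f (merge K B (x, w)) - f (merge K B (y, w))\<bar> \<partial>PiM B D)"
      by (simp add: integral_abs_bound)
    also have "\<dots> \<le> (\<integral>w. c \<partial>PiM B D)"
      using that
      by (intro integral_mono integrable_abs Bochner_Integration.integrable_diff int_sec dif[of _ _ k'] mg)
        (auto simp: merge_def)
    finally show ?thesis by (simp add: PB.prob_space)
  qed
  have EF: "(\<integral>x. f x \<partial>PiM (K \<union> B) D) = (\<integral>x. F x \<partial>PiM K D)"
    unfolding F_def by (rule product_integral_fold) (use J int_f in auto)
  define e where "e = (\<integral>x. F x \<partial>PiM K D)"
  have int_exp: "integrable (PiM (K \<union> B) D) (\<lambda>x. exp (f x - e))"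
    by (intro PJ.integrable_const_bound[of _ "exp (b - e)"] AE_I2)
       (use bnd in \<open>fastforce simp: abs_le_iff\<close>)+
  \<comment> \<open>For frozen \<open>x\<close>, the section has mean \<open>F x\<close> and
    oscillation at most \<open>c\<close>, since two merged points differ only at level
    \<open>k\<close>.\<close>
  have inner: "(\<integral>y. exp (f (merge K B (x, y)) - e) \<partial>PiM B D) \<le> exp (F x - e) * exp (c\<^sup>2 / 2)"
    if x: "x \<in> space (PiM K D)" for x
  proof -
    have "(\<integral>y. exp (f (merge K B (x, y)) - e) \<partial>PiM B D)
        = exp (F x - e) * (\<integral>y. exp (f (merge K B (x, y)) - F x) \<partial>PiM B D)"
      by (subst integral_mult_right_zero[symmetric]) (simp flip: exp_add)
    also have "\<dots> \<le> exp (F x - e) * exp (c\<^sup>2 / 2)"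
      unfolding F_def using x
      by (intro mult_left_mono PB.Hoeffdings_lemma_centered sec dif[of _ _ k] mg)
         (auto simp: merge_def K_def B_def)
    finally show ?thesis .
  qed
  have "(\<integral>x. exp (f x - (\<integral>y. f y \<partial>PiM J D)) \<partial>PiM J D) = (\<integral>x. exp (f x - e) \<partial>PiM (K \<union> B) D)"
    by (simp add: J(1) EF e_def)
  also have "\<dots> = (\<integral>x. (\<integral>y. exp (f (merge K B (x, y)) - e) \<partial>PiM B D) \<partial>PiM K D)"
    by (rule product_integral_fold) (use J int_exp in auto)
  also have "\<dots> \<le> (\<integral>x. exp (F x - e) * exp (c\<^sup>2 / 2) \<partial>PiM K D)"
  proof (rule integral_mono)
    show int_F: "integrable (PiM K D) (\<lambda>x. exp (F x - e) * exp (c\<^sup>2 / 2))"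
      by (intro PK.integrable_const_bound[of _ "exp (b - e) * exp (c\<^sup>2 / 2)"] AE_I2)
         (use bF in \<open>fastforce simp: abs_le_iff\<close>)+
    show "integrable (PiM K D) (\<lambda>x. \<integral>y. exp (f (merge K B (x, y)) - e) \<partial>PiM B D)"
    proof (rule Bochner_Integration.integrable_bound[OF int_F])
      show "AE x in PiM K D. norm (\<integral>y. exp (f (merge K B (x, y)) - e) \<partial>PiM B D)
         \<le> norm (exp (F x - e) * exp (c\<^sup>2 / 2))"
        using inner by (intro AE_I2) (auto simp: integral_nonneg_AE)
    qed measurable
  qed (rule inner)
  also have "\<dots> = (\<integral>x. exp (F x - (\<integral>y. F y \<partial>PiM K D)) \<partial>PiM K D) * exp (c\<^sup>2 / 2)"
    by (simp add: e_def)
  also have "\<dots> \<le> exp (c\<^sup>2 * real (card L) / 2) * exp (c\<^sup>2 / 2)"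
  proof (intro mult_right_mono insert.IH J(3) mF bF dF)
    show "lev ` K \<subseteq> L"
      using insert.prems(2) by (auto simp: K_def)
  qed auto
  also have "\<dots> = exp (c\<^sup>2 * real (card (insert k L)) / 2)"
    using insert.hyps by (simp flip: exp_add add: field_simps)
  finally show ?case .
qed

text \<open>Chernoff's bound is applied to \<open>Y\<close> and to \<open>- Y\<close>; the moment
  bound for all real \<open>l\<close> covers both signs.\<close>

lemma (in prob_space) subgaussian_tail:
  fixes Y :: "'a \<Rightarrow> real"
  assumes [measurable]: "random_variable borel Y"
    and int: "\<And>l. integrable M (\<lambda>x. exp (l * Y x))"
    and mgf: "\<And>l. expectation (\<lambda>x. exp (l * Y x)) \<le> exp (l\<^sup>2 * s / 2)"
    and "0 < s" "0 < t"
  shows "prob {x\<in>space M. t \<le> \<bar>Y x\<bar>} \<le> 2 * exp (- t\<^sup>2 / (2 * s))"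
proof -
  have half: "prob {x\<in>space M. t \<le> \<epsilon> * Y x} \<le> exp (- t\<^sup>2 / (2 * s))" if \<epsilon>: "\<epsilon>\<^sup>2 = 1" for \<epsilon> :: real
  proof -
    \<comment> \<open>The minimiser of \<open>l^2 * s / 2 - l * t\<close>.\<close>
    define l where "l = t / s"
    have l: "0 < l" using assms by (simp add: l_def)
    have int': "integrable M (\<lambda>x. exp (l * (\<epsilon> * Y x)))"
      using int[of "l * \<epsilon>"] by (simp add: mult.assoc)
    have ind: "(\<lambda>x. indicator (space M) x *\<^sub>R exp (l * (\<epsilon> * Y x))) \<in> borel_measurable M"
      by measurable
    have "prob {x\<in>space M. t \<le> \<epsilon> * Y x} \<le> exp (-l * t) * (\<integral>x\<in>space M. exp (l * (\<epsilon> * Y x)) \<partial>M)"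
    proof (rule Chernoff_ineq_ge[OF l])
      show "set_integrable M (space M) (\<lambda>x. exp (l * (\<epsilon> * Y x)))"
        unfolding set_integrable_def
        by (rule Bochner_Integration.integrable_bound[OF int' ind]) (auto simp: indicator_def)
    qed auto
    also have "(\<integral>x\<in>space M. exp (l * (\<epsilon> * Y x)) \<partial>M) = expectation (\<lambda>x. exp ((l * \<epsilon>) * Y x))"
      using int' by (subst set_integral_space) (simp_all add: mult.assoc)
    also have "\<dots> \<le> exp ((l * \<epsilon>)\<^sup>2 * s / 2)"
      by (rule mgf)
    also have "(l * \<epsilon>)\<^sup>2 = l\<^sup>2"
      using \<epsilon> by (simp add: power_mult_distrib)
    also have "exp (-l * t) * exp (l\<^sup>2 * s / 2) = exp (- t\<^sup>2 / (2 * s))"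
      unfolding exp_add[symmetric] l_def using \<open>0 < s\<close> by (simp add: power2_eq_square field_simps)
    finally show ?thesis by simp
  qed
  have "prob {x\<in>space M. t \<le> \<bar>Y x\<bar>} \<le> prob ({x\<in>space M. t \<le> 1 * Y x} \<union> {x\<in>space M. t \<le> - 1 * Y x})"
    by (intro finite_measure_mono) (auto simp: abs_if split: if_splits)
  also have "\<dots> \<le> prob {x\<in>space M. t \<le> 1 * Y x} + prob {x\<in>space M. t \<le> - 1 * Y x}"
    by (intro measure_Un_le) auto
  also have "\<dots> \<le> exp (- t\<^sup>2 / (2 * s)) + exp (- t\<^sup>2 / (2 * s))"
    by (intro add_mono half) auto
  finally show ?thesis by simp
qed

text \<open>The terms are union bounds for the bad events: the power bounds the number of points in
  the cube of radius \<open>n^2\<close>, \<open>n + 1\<close> counts the horizons up to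
  \<open>n\<close>, and the exponential is the tail of a single deviation.\<close>

lemma summable_poly_stretched_exp:
  fixes \<kappa> :: real and d :: nat
  assumes "0 < \<kappa>"
  shows "summable (\<lambda>n. real (nat (2 * (int n)\<^sup>2 + 1) ^ d) * (real n + 1) * (2 * exp (- \<kappa> * real n powr (1/2))))"
proof -
  have "\<forall>\<^sub>F n in sequentially. norm (real (nat (2 * (int n)\<^sup>2 + 1) ^ d) * (real n + 1) * (2 * exp (- \<kappa> * real n powr (1/2))))
     \<le> (1 / real n ^ 2)"
  proof -
    define e where "e = real d"
    have ev: "\<forall>\<^sub>F n in sequentially. (2 * real n ^ 2 + 1) powr e * (real n + 1) * (2 * exp (- \<kappa> * real n powr (1/2))) \<le> 1 / real n ^ 2"
      using assms unfolding e_def by real_asymp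
    have "(2 * (real n)\<^sup>2 + 1) ^ d = (2 * (real n)\<^sup>2 + 1) powr e" for n
      by (simp add: e_def powr_realpow add_nonneg_pos)
    moreover have "nat (2 * (int n)\<^sup>2 + 1) = 2 * n\<^sup>2 + 1" for n
      by (simp add: nat_add_distrib nat_mult_distrib nat_power_eq)
    ultimately have eq: "real (nat (2 * (int n)\<^sup>2 + 1) ^ d) = (2 * real n ^ 2 + 1) powr e" for n
      by (simp add: add.commute)
    show ?thesis
      using ev by eventually_elim (simp only: eq real_norm_def, simp add: abs_mult)
  qed
  then show ?thesis
    by (rule summable_comparison_test_ev) (use inverse_power_summable[of 2] in \<open>simp add: field_simps\<close>)
qed

section \<open>Lattice cubes and integral heights\<close>

text \<open>The scalar product with \<open>u\<close>, kept integral so that its values form discrete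
  levels and any positive increase is at least 1.\<close>

definition height :: "int ^ 'd \<Rightarrow> int ^ 'd \<Rightarrow> int" where
  "height u z = (\<Sum>k\<in>UNIV. u $ k * z $ k)"

lemma height_add: "height u (z + w) = height u z + height u w"
  by (simp add: height_def distrib_left sum.distrib)

definition cube :: "int \<Rightarrow> (int ^ 'd) set" where
  "cube r = {z. \<forall>k. \<bar>z $ k\<bar> \<le> r}"

lemma cube_add: "z \<in> cube r \<Longrightarrow> w \<in> cube s \<Longrightarrow> z + w \<in> cube (r + s)"
  unfolding cube_def mem_Collect_eq vector_add_component
  by (meson abs_triangle_ineq add_mono order_trans)

lemma cube_mono: "r \<le> s \<Longrightarrow> cube r \<subseteq> cube s"
  by (auto simp: cube_def intro: order_trans)

lemma zero_in_cube: "0 \<le> r \<Longrightarrow> 0 \<in> cube r"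
  by (simp add: cube_def)

lemma cube_subset_image:
  "(cube r :: (int ^ 'd) set) \<subseteq> vec_lambda ` (UNIV \<rightarrow>\<^sub>E {-r..r})"
proof
  fix z :: "int ^ 'd"
  assume z: "z \<in> cube r"
  show "z \<in> vec_lambda ` (UNIV \<rightarrow>\<^sub>E {-r..r})"
  proof (rule image_eqI)
    show "z = vec_lambda (($) z)" by simp
    show "($) z \<in> UNIV \<rightarrow>\<^sub>E {-r..r}"
      using z by (auto simp: cube_def abs_le_iff minus_le_iff)
  qed
qed

lemma finite_cube [simp]: "finite (cube r :: (int ^ 'd) set)"
  by (rule finite_subset[OF cube_subset_image]) (intro finite_imageI finite_PiE, auto)

lemma card_cube_le:
  "card (cube r :: (int ^ 'd) set) \<le> nat (2 * r + 1) ^ CARD('d)"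
proof -
  have fin: "finite ((UNIV :: 'd set) \<rightarrow>\<^sub>E {-r..r})"
    by (intro finite_PiE) auto
  have "card (cube r :: (int ^ 'd) set) \<le> card ((UNIV :: 'd set) \<rightarrow>\<^sub>E {-r..r})"
    by (rule order_trans[OF card_mono[OF _ cube_subset_image] card_image_le]) (use fin in auto)
  also have "\<dots> = nat (2 * r + 1) ^ CARD('d)"
    by (simp add: card_PiE)
  finally show ?thesis .
qed

lemma height_cube_le:
  assumes "z \<in> cube r"
  shows "\<bar>height u z\<bar> \<le> (\<Sum>k\<in>UNIV. \<bar>u $ k\<bar>) * r"
proof -
  have "\<bar>height u z\<bar> \<le> (\<Sum>k\<in>UNIV. \<bar>u $ k\<bar> * \<bar>z $ k\<bar>)"
    unfolding height_def by (rule order_trans[OF sum_abs]) (simp add: abs_mult)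
  also have "\<dots> \<le> (\<Sum>k\<in>UNIV. \<bar>u $ k\<bar> * r)"
    using assms by (intro sum_mono mult_left_mono) (auto simp: cube_def)
  finally show ?thesis
    by (simp add: sum_distrib_right)
qed

lemma cube_exhausts: "\<exists>r. 0 \<le> r \<and> z \<in> cube r"
proof (intro exI conjI)
  show "0 \<le> (\<Sum>k\<in>UNIV. \<bar>z $ k\<bar>)"
    by (intro sum_nonneg) auto
  show "z \<in> cube (\<Sum>k\<in>UNIV. \<bar>z $ k\<bar>)"
    unfolding cube_def by (auto intro!: member_le_sum)
qed

lemma finite_subset_cube:
  assumes "finite A"
  shows "\<exists>r\<ge>0. A \<subseteq> cube r"
  using assms
proof induction
  case (insert z A)
  then obtain r where r: "0 \<le> r" "A \<subseteq> cube r" by blast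
  obtain s where s: "0 \<le> s" "z \<in> cube s" using cube_exhausts by blast
  have "insert z A \<subseteq> cube (max r s)"
    using r s cube_mono[of r "max r s"] cube_mono[of s "max r s"] by auto
  then show ?case
    using r(1) by (intro exI[of _ "max r s"]) auto
qed auto

text \<open>Strict separation gives a real functional \<open>a\<close> exceeding some
  \<open>b > 0\<close> on the actions. Rounding down the coordinates of a large multiple of
  \<open>a\<close> lowers the height of an action by at most the dimension times \<open>B\<close>,
  which the enlarged margin outweighs.\<close>

lemma integral_height_exists:
  fixes I :: "(int ^ 'd) set"
  assumes "finite I" "0 \<notin> convex hull (vec_of_int ` I)"
  shows "\<exists>u. \<forall>i\<in>I. 1 \<le> height u i"
proof -
  have "compact (convex hull (vec_of_int ` I))"
    using assms(1) by (intro finite_imp_compact_convex_hull finite_imageI)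
  then obtain a :: "real ^ 'd" and b where b: "0 < b" "\<And>x. x \<in> convex hull (vec_of_int ` I) \<Longrightarrow> b < a \<bullet> x"
    using separating_hyperplane_closed_0[of "convex hull (vec_of_int ` I)"] assms(2)
    by (metis compact_imp_closed convex_convex_hull)
  obtain B where B: "I \<subseteq> cube B"
    using finite_subset_cube[OF assms(1)] by blast
  \<comment> \<open>\<open>N * b\<close> is 1 plus the largest rounding loss, so at least 1
    survives. The absolute value below spares a case on the sign of \<open>N\<close>.\<close>
  define N where "N = (1 + real CARD('d) * B) / b"
  define u :: "int ^ 'd" where "u = (\<chi> k. \<lfloor>\<bar>N\<bar> * a $ k\<rfloor>)"
  have "1 \<le> height u i" if i: "i \<in> I" for i
  proof -
    have "vec_of_int i \<in> convex hull (vec_of_int ` I)"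
      using i by (simp add: hull_inc)
    then have ai: "b < (\<Sum>k\<in>UNIV. a $ k * real_of_int (i $ k))"
      using b(2) by (fastforce simp: inner_vec_def vec_of_int_def)
    have "\<bar>N\<bar> * (\<Sum>k\<in>UNIV. a $ k * real_of_int (i $ k)) - height u i
        = (\<Sum>k\<in>UNIV. (\<bar>N\<bar> * a $ k - of_int (u $ k)) * real_of_int (i $ k))"
      by (simp add: height_def sum_distrib_left sum_subtractf left_diff_distrib mult.assoc)
    also have "\<dots> \<le> (\<Sum>k\<in>(UNIV::'d set). real_of_int B)"
    proof (rule sum_mono)
      fix k
      have "\<bar>\<bar>N\<bar> * a $ k - of_int (u $ k)\<bar> \<le> 1"
        unfolding u_def by (simp add: abs_le_iff) linarith
      moreover have "\<bar>real_of_int (i $ k)\<bar> \<le> B"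
        using B i by (force simp: cube_def simp flip: of_int_abs)
      ultimately have "\<bar>(\<bar>N\<bar> * a $ k - of_int (u $ k)) * real_of_int (i $ k)\<bar> \<le> 1 * real_of_int B"
        unfolding abs_mult by (intro mult_mono) auto
      then show "(\<bar>N\<bar> * a $ k - of_int (u $ k)) * real_of_int (i $ k) \<le> B"
        by simp
    qed
    finally have "\<bar>N\<bar> * (\<Sum>k\<in>UNIV. a $ k * real_of_int (i $ k)) - height u i \<le> real CARD('d) * B"
      by simp
    moreover have "1 + real CARD('d) * B \<le> \<bar>N\<bar> * (\<Sum>k\<in>UNIV. a $ k * real_of_int (i $ k))"
    proof -
      have "1 + real CARD('d) * B = N * b"
        using b(1) by (simp add: N_def)
      also have "\<dots> \<le> \<bar>N\<bar> * b"
        using b(1) by (intro mult_right_mono) auto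
      also have "\<dots> \<le> \<bar>N\<bar> * (\<Sum>k\<in>UNIV. a $ k * real_of_int (i $ k))"
        using ai by (intro mult_left_mono) auto
      finally show ?thesis .
    qed
    ultimately have "1 \<le> real_of_int (height u i)"
      by linarith
    then show ?thesis by simp
  qed
  then show ?thesis by blast
qed

section \<open>Optimal path totals\<close>

text \<open>The Bellman recursion for the best total over \<open>n\<close> steps, for one fixed
  realisation \<open>G\<close> of the payoffs.\<close>

primrec max_total :: "'a::plus set \<Rightarrow> ('a \<Rightarrow> 'a \<Rightarrow> real) \<Rightarrow> nat \<Rightarrow> 'a \<Rightarrow> real" where
  "max_total I G 0 z = 0"
| "max_total I G (Suc n) z = Max ((\<lambda>i. G z i + max_total I G n (z + i)) ` I)"

text \<open>Payoffs are centred by \<open>v\<close> and switched off from height \<open>T\<close>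
  on, so the total of a long path counts only its stretch inside the band.\<close>

definition truncated ::
  "(int ^ 'd) \<Rightarrow> int \<Rightarrow> real \<Rightarrow> (int ^ 'd \<Rightarrow> int ^ 'd \<Rightarrow> real) \<Rightarrow> int ^ 'd \<Rightarrow> int ^ 'd \<Rightarrow> real" where
  "truncated u T v G z i = (if height u z < T then G z i - v else 0)"

section \<open>Dyadic bands and potentials along them\<close>

text \<open>For \<open>x \<ge> 1\<close> this is the right end of the dyadic band containing
  \<open>x\<close>; all \<open>x \<le> 0\<close> share the value 1.\<close>

definition dyadic_above :: "int \<Rightarrow> int" where
  "dyadic_above x = 2 ^ (LEAST k. x < 2 ^ k)"

lemma less_dyadic_above: "x < dyadic_above x"
proof -
  have "x < 2 ^ nat \<bar>x\<bar>"
    by (metis abs_ge_self int_nat_eq less_exp nat_int of_nat_less_iff of_nat_numeral of_nat_power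
        order_le_less_trans abs_ge_zero)
  then show ?thesis
    unfolding dyadic_above_def by (rule LeastI)
qed

lemma dyadic_above_mono_cases:
  assumes "x \<le> y"
  shows "dyadic_above x = dyadic_above y \<or> 2 * dyadic_above x \<le> dyadic_above y"
proof -
  define a where "a = (LEAST k. x < 2 ^ k)"
  define b where "b = (LEAST k. y < 2 ^ k)"
  have "y < 2 ^ b"
    using less_dyadic_above[of y] by (simp add: dyadic_above_def b_def)
  then have "a \<le> b"
    unfolding a_def using assms by (intro Least_le) simp
  then consider "a = b" | "Suc a \<le> b" by linarith
  then show ?thesis
  proof cases
    case 2
    then have "(2::int) ^ Suc a \<le> 2 ^ b" by (rule power_increasing) simp
    then show ?thesis by (simp add: dyadic_above_def a_def b_def)
  qed (simp add: dyadic_above_def a_def b_def)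
qed

lemma dyadic_above_eq:
  assumes "x \<le> y" "y < dyadic_above x"
  shows "dyadic_above y = dyadic_above x"
proof -
  have "dyadic_above y \<le> dyadic_above x"
    unfolding dyadic_above_def[of y] using assms(2)
    by (simp add: dyadic_above_def Least_le power_increasing)
  moreover have "0 < dyadic_above x"
    by (simp add: dyadic_above_def)
  ultimately show ?thesis
    using dyadic_above_mono_cases[OF assms(1)] by linarith
qed

lemma dyadic_above_le:
  assumes "1 \<le> x"
  shows "dyadic_above x \<le> 2 * x"
proof -
  define k where "k = (LEAST k. x < 2 ^ k)"
  have "x < 2 ^ k"
    using less_dyadic_above[of x] by (simp add: dyadic_above_def k_def)
  then obtain l where l: "k = Suc l"
    using assms by (cases k) auto
  then have "\<not> x < 2 ^ l"
    using not_less_Least[of l "\<lambda>k. x < 2 ^ k"] by (simp add: k_def)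
  then show ?thesis
    using l by (simp add: dyadic_above_def k_def)
qed

text \<open>At each change of dyadic band the bound \<open>2 * \<delta> * dyadic_above (x n)\<close> at least doubles,
  which pays for the new potential.\<close>

lemma band_sum_lower_bound:
  fixes x :: "nat \<Rightarrow> int" and p r :: "nat \<Rightarrow> real" and \<delta> :: real
  assumes inc: "\<And>j. x j < x (Suc j)"
    and p: "\<And>j. p j = r j + (if dyadic_above (x (Suc j)) = dyadic_above (x j) then p (Suc j) else 0)"
    and small: "\<And>j. j \<ge> j0 \<Longrightarrow> \<bar>p j\<bar> \<le> \<delta> * x j"
    and "0 \<le> \<delta>" "j0 \<le> n"
  shows "(\<Sum>j=j0..<n. r j)
    \<ge> p j0 + 2 * \<delta> * dyadic_above (x j0) - p n - 2 * \<delta> * dyadic_above (x n)"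
  using \<open>j0 \<le> n\<close>
proof (induction n rule: dec_induct)
  case base
  then show ?case by simp
next
  case (step n)
  \<comment> \<open>Inside a band \<open>p\<close> telescopes. When the right end changes from
    \<open>D\<close> to \<open>D'\<close>, then \<open>D' \<ge> 2 * D\<close>, so
    \<open>2 * \<delta> * (D' - D)\<close> is at least \<open>\<delta> * D'\<close> and outweighs
    \<open>- p (Suc n)\<close>.\<close>
  have "r n \<ge> p n + 2 * \<delta> * dyadic_above (x n) - p (Suc n) - 2 * \<delta> * dyadic_above (x (Suc n))"
  proof (cases "dyadic_above (x (Suc n)) = dyadic_above (x n)")
    case True
    then show ?thesis using p[of n] by simp
  next
    case False
    have "real_of_int (2 * dyadic_above (x n)) \<le> dyadic_above (x (Suc n))"
      using dyadic_above_mono_cases[of "x n" "x (Suc n)"] inc[of n] False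
      by (intro of_int_le_iff[THEN iffD2]) auto
    then have "\<delta> * (2 * dyadic_above (x n)) \<le> \<delta> * dyadic_above (x (Suc n))"
      using \<open>0 \<le> \<delta>\<close> by (intro mult_left_mono) auto
    moreover have "\<delta> * x (Suc n) \<le> \<delta> * dyadic_above (x (Suc n))"
      using \<open>0 \<le> \<delta>\<close> less_dyadic_above[of "x (Suc n)"] by (intro mult_left_mono) auto
    moreover have "- p (Suc n) \<le> \<delta> * x (Suc n)"
      using small[of "Suc n"] step.hyps by (simp add: abs_le_iff)
    ultimately show ?thesis using False p[of n] by simp
  qed
  then show ?case
    using step.IH step.hyps by simp
qed

text \<open>The height \<open>x\<close> grows at most linearly, so the boundary terms at
  \<open>n\<close> in the sum bound, of order \<open>\<delta> * x n\<close>, amount to a small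
  multiple of \<open>n\<close>.\<close>

lemma band_average_lower_bound:
  fixes x :: "nat \<Rightarrow> int" and p r :: "nat \<Rightarrow> real" and K \<epsilon> :: real
  assumes inc: "\<And>j. x j < x (Suc j)"
    and le: "\<And>j. real_of_int (x j) \<le> x 0 + K * j"
    and p: "\<And>j. p j = r j + (if dyadic_above (x (Suc j)) = dyadic_above (x j) then p (Suc j) else 0)"
    and small: "\<And>\<delta>::real. 0 < \<delta> \<Longrightarrow> \<forall>\<^sub>F j in sequentially. \<bar>p j\<bar> \<le> \<delta> * x j"
    and "0 < \<epsilon>"
  shows "\<forall>\<^sub>F n in sequentially. (\<Sum>j<n. r j) \<ge> - \<epsilon> * n"
proof -
  have K: "K \<ge> 1"
    using le[of 1] inc[of 0] by simp
  \<comment> \<open>\<open>p n\<close> costs \<open>\<delta> * x n\<close> and the dyadic term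
    \<open>4 * \<delta> * x n\<close>. Up to a constant, together they use half of
    \<open>\<epsilon> * n\<close>; the other half absorbs the constant \<open>c\<close>.\<close>
  define \<delta> where "\<delta> = \<epsilon> / (10 * K)"
  have \<delta>: "0 < \<delta>" "5 * \<delta> * K = \<epsilon> / 2"
    using K \<open>0 < \<epsilon>\<close> by (auto simp: \<delta>_def)
  have x_ge: "x 0 + int j \<le> x j" for j
  proof (induction j)
    case (Suc j)
    then show ?case using inc[of j] by simp
  qed simp
  have "\<forall>\<^sub>F j in sequentially. \<bar>p j\<bar> \<le> \<delta> * x j \<and> 1 \<le> x j"
  proof (rule eventually_conj[OF small[OF \<delta>(1)]])
    show "\<forall>\<^sub>F j in sequentially. 1 \<le> x j"
      using eventually_ge_at_top[of "nat (1 - x 0)"] 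
    proof eventually_elim
      case (elim j)
      then show ?case using x_ge[of j] by linarith
    qed
  qed
  then obtain j0 where j0: "\<And>j. j \<ge> j0 \<Longrightarrow> \<bar>p j\<bar> \<le> \<delta> * x j \<and> 1 \<le> x j"
    unfolding eventually_sequentially by blast
  define c where "c = (\<Sum>j<j0. r j) + p j0 + 2 * \<delta> * dyadic_above (x j0) - 5 * \<delta> * x 0"
  have low: "(\<Sum>j<n. r j) \<ge> c - \<epsilon> / 2 * n" if n: "n \<ge> j0" for n
  proof -
    have "(\<Sum>j<n. r j) = (\<Sum>j<j0. r j) + (\<Sum>j=j0..<n. r j)"
      using n by (metis atLeast0LessThan bot_nat_0.extremum sum.atLeastLessThan_concat)
    moreover have "(\<Sum>j=j0..<n. r j)
      \<ge> p j0 + 2 * \<delta> * dyadic_above (x j0) - p n - 2 * \<delta> * dyadic_above (x n)"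
      using j0 n \<delta> by (intro band_sum_lower_bound inc p) auto
    moreover have "p n \<le> \<delta> * x n"
      using j0[OF n] by (simp add: abs_le_iff)
    moreover have "\<delta> * dyadic_above (x n) \<le> 2 * (\<delta> * x n)"
    proof -
      have "real_of_int (dyadic_above (x n)) \<le> real_of_int (2 * x n)"
        using j0[OF n] dyadic_above_le[of "x n"] by (intro of_int_le_iff[THEN iffD2]) auto
      then have "\<delta> * dyadic_above (x n) \<le> \<delta> * (2 * x n)"
        using \<delta>(1) by (intro mult_left_mono) auto
      then show ?thesis by simp
    qed
    moreover have "5 * (\<delta> * x n) \<le> 5 * \<delta> * x 0 + \<epsilon> / 2 * n"
    proof -
      have "5 * \<delta> * x n \<le> 5 * \<delta> * (x 0 + K * n)"
        using \<delta>(1) by (intro mult_left_mono le) auto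
      also have "\<dots> = 5 * \<delta> * x 0 + (5 * \<delta> * K) * n"
        by (simp add: distrib_left)
      finally show ?thesis
        unfolding \<delta>(2) by simp
    qed
    ultimately show ?thesis
      unfolding c_def by linarith
  qed
  have "\<forall>\<^sub>F n in sequentially. c - \<epsilon> / 2 * real n \<ge> - \<epsilon> * n"
    using \<open>0 < \<epsilon>\<close> by real_asymp
  then show ?thesis
    using eventually_ge_at_top[of j0] by eventually_elim (use low in force)
qed

section \<open>Dynamic programming for steps of positive height\<close>

locale directed_steps =
  fixes I :: "(int ^ 'd) set" and u :: "int ^ 'd" and B :: int
  assumes finite_steps: "finite I" and steps_nonempty: "I \<noteq> {}"
    and height_step: "i \<in> I \<Longrightarrow> 1 \<le> height u i"
    and steps_in_cube: "I \<subseteq> cube B"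
begin

abbreviation "V \<equiv> max_total I"

lemma B_nonneg: "0 \<le> B"
  using steps_nonempty steps_in_cube by (fastforce simp: cube_def)

lemma step_in_cube: "z \<in> cube r \<Longrightarrow> i \<in> I \<Longrightarrow> z + i \<in> cube (r + B)"
  using cube_add steps_in_cube by blast

lemma cube_Suc: "cube (r + B + int n * B) = cube (r + int (Suc n) * B)"
  by (simp add: algebra_simps)

lemma cube_later: "z \<in> cube r \<Longrightarrow> z \<in> cube (r + int n * B)"
  using cube_mono[of r "r + int n * B"] B_nonneg by auto

lemma V_ge: "i \<in> I \<Longrightarrow> G z i + V G n (z + i) \<le> V G (Suc n) z"
  using finite_steps by (auto intro: Max_ge)

lemma V_attained: "\<exists>i\<in>I. V G (Suc n) z = G z i + V G n (z + i)"
proof -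
  have "Max ((\<lambda>i. G z i + V G n (z + i)) ` I) \<in> (\<lambda>i. G z i + V G n (z + i)) ` I"
    using finite_steps steps_nonempty by (intro Max_in) auto
  then show ?thesis
    by (simp only: max_total.simps image_iff Bex_def)
qed

text \<open>Inserting the maximiser of each side into the other compares the two maxima termwise.
  The offset \<open>\<beta>\<close> allows for different horizons.\<close>

lemma V_diff_le:
  assumes "\<And>i. i \<in> I \<Longrightarrow> \<bar>(G z i + V G m (z + i)) - (G' z' i + V G' n (z' + i)) - \<beta>\<bar> \<le> e"
  shows "\<bar>V G (Suc m) z - V G' (Suc n) z' - \<beta>\<bar> \<le> e"
proof -
  obtain i where i: "i \<in> I" "V G (Suc m) z = G z i + V G m (z + i)"
    using V_attained by blast
  obtain j where j: "j \<in> I" "V G' (Suc n) z' = G' z' j + V G' n (z' + j)"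
    using V_attained by blast
  show ?thesis
    using assms[OF i(1)] assms[OF j(1)] i(2) j(2) V_ge[OF i(1), of G' z' n] V_ge[OF j(1), of G z m]
    by (simp add: abs_le_iff)
qed

text \<open>Steps move at most \<open>B\<close> in each coordinate, so payoffs outside a finite cube
  cannot matter. This later turns the total into a function of finitely many random
  variables.\<close>

lemma V_cong:
  assumes "z \<in> cube r" "\<And>w i. w \<in> cube (r + int n * B) \<Longrightarrow> i \<in> I \<Longrightarrow> G w i = G' w i"
  shows "V G n z = V G' n z"
  using assms
proof (induction n arbitrary: z r)
  case (Suc n)
  have "V G n (z + i) = V G' n (z + i)" if "i \<in> I" for i
    using step_in_cube[OF Suc.prems(1) that] Suc.prems(2) by (rule Suc.IH) (simp_all only: cube_Suc)
  moreover have "G z i = G' z i" if "i \<in> I" for i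
    using Suc.prems(2) cube_later[OF Suc.prems(1)] that by blast
  ultimately show ?case
    by (simp cong: image_cong_simp)
qed simp

lemma V_shift: "V G n (z + w) = V (\<lambda>x. G (z + x)) n w"
  by (induction n arbitrary: w) (simp_all add: add.assoc)

lemma V_abs_le:
  assumes "\<And>w i. i \<in> I \<Longrightarrow> \<bar>G w i\<bar> \<le> C"
  shows "\<bar>V G n z\<bar> \<le> C * real n"
proof (induction n arbitrary: z)
  case (Suc n)
  obtain i where "i \<in> I" "V G (Suc n) z = G z i + V G n (z + i)"
    using V_attained by blast
  then show ?case
    using Suc.IH[of "z + i"] assms[of i z] by (auto simp: abs_le_iff algebra_simps)
qed simp

text \<open>A path meets each level of \<open>height u\<close> at most once.\<close>

lemma V_change_level:
  assumes "\<And>w i. i \<in> I \<Longrightarrow> \<bar>G w i - G' w i\<bar> \<le> c"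
    and "\<And>w i. i \<in> I \<Longrightarrow> height u w \<noteq> k \<Longrightarrow> G w i = G' w i"
  shows "\<bar>V G n z - V G' n z\<bar> \<le> (if height u z \<le> k then c else 0)"
proof -
  have c: "0 \<le> c"
    using assms(1) steps_nonempty by (meson abs_ge_zero ex_in_conv order_trans)
  show ?thesis
  proof (induction n arbitrary: z)
    case 0
    then show ?case using c by simp
  next
    case (Suc n)
    have "\<bar>V G (Suc n) z - V G' (Suc n) z - 0\<bar> \<le> (if height u z \<le> k then c else 0)"
    proof (rule V_diff_le)
      \<comment> \<open>At height \<open>k\<close> only the current payoff changes, since the
        successor is higher; below \<open>k\<close> only the continuation changes; above
        \<open>k\<close> nothing does.\<close>
      fix i assume i: "i \<in> I"
      show "\<bar>G z i + V G n (z + i) - (G' z i + V G' n (z + i)) - 0\<bar> \<le> (if height u z \<le> k then c else 0)"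
        using Suc.IH[of "z + i"] height_step[OF i] assms(1)[OF i, of z] assms(2)[OF i, of z]
        by (auto simp: height_add split: if_splits)
    qed
    then show ?case by simp
  qed
qed

lemma V_measurable:
  assumes "\<And>w i. i \<in> I \<Longrightarrow> (\<lambda>\<omega>. G \<omega> w i) \<in> borel_measurable N"
  shows "(\<lambda>\<omega>. V (G \<omega>) n z) \<in> borel_measurable N"
  using assms finite_steps
  by (induction n arbitrary: z) (auto intro!: borel_measurable_Max borel_measurable_add)

text \<open>The last \<open>n\<close> steps are worth \<open>\<beta>\<close> up to \<open>e\<close>
  from every state reachable in \<open>m\<close> steps, whichever path led there.\<close>

lemma V_split:
  assumes "z \<in> cube r" "\<And>w. w \<in> cube (r + int m * B) \<Longrightarrow> \<bar>V G n w - \<beta>\<bar> \<le> e"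
  shows "\<bar>V G (m + n) z - V G m z - \<beta>\<bar> \<le> e"
  using assms
proof (induction m arbitrary: z r)
  case (Suc m)
  have "\<bar>V G (Suc (m + n)) z - V G (Suc m) z - \<beta>\<bar> \<le> e"
  proof (rule V_diff_le)
    fix i assume i: "i \<in> I"
    have "\<bar>V G (m + n) (z + i) - V G m (z + i) - \<beta>\<bar> \<le> e"
      using step_in_cube[OF Suc.prems(1) i] Suc.prems(2) by (rule Suc.IH) (simp_all only: cube_Suc)
    then show "\<bar>G z i + V G (m + n) (z + i) - (G z i + V G m (z + i)) - \<beta>\<bar> \<le> e"
      by simp
  qed
  then show ?case by simp
qed simp

section \<open>Payoffs truncated at a height\<close>

lemma V_truncated_above:
  assumes "T \<le> height u z"
  shows "V (truncated u T v G) n z = 0"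
  using assms
proof (induction n arbitrary: z)
  case (Suc n)
  have "V (truncated u T v G) n (z + i) = 0" if "i \<in> I" for i
    using Suc.prems height_step[OF that] by (intro Suc.IH) (simp add: height_add)
  moreover obtain i where "i \<in> I"
      "V (truncated u T v G) (Suc n) z = truncated u T v G z i + V (truncated u T v G) n (z + i)"
    using V_attained by blast
  ultimately show ?case
    using Suc.prems by (simp add: truncated_def[of u T v G z] del: max_total.simps(2))
qed simp

text \<open>Every step gains height at least 1, so both horizons suffice to reach \<open>T\<close>;
  afterwards only zeros are added.\<close>

lemma V_truncated_eq:
  assumes "T - height u z \<le> int m" "T - height u z \<le> int n"
  shows "V (truncated u T v G) m z = V (truncated u T v G) n z"
  using assms
proof (induction m arbitrary: n z)
  case 0
  then show ?case by (simp add: V_truncated_above)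
next
  case (Suc m)
  show ?case
  proof (cases n)
    case 0
    then show ?thesis using Suc.prems V_truncated_above[of T z v G "Suc m"] by simp
  next
    case (Suc n')
    have "V (truncated u T v G) m (z + i) = V (truncated u T v G) n' (z + i)" if "i \<in> I" for i
      using Suc.prems Suc height_step[OF that] by (intro Suc.IH) (auto simp: height_add)
    then show ?thesis
      unfolding Suc by (simp cong: image_cong_simp)
  qed
qed

text \<open>An optimal path for \<open>G\<close> is followed. Where it leaves the band with
  \<open>m\<close> steps left, the discarded tail is worth at most \<open>m * v + e\<close>, so
  truncation costs at most \<open>e\<close>.\<close>

lemma V_truncated_lower:
  assumes "z \<in> cube r"
    "\<And>m w. m \<le> n \<Longrightarrow> w \<in> cube (r + int n * B) \<Longrightarrow> \<bar>V G m w - real m * v\<bar> \<le> e"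
  shows "V G n z - real n * v - e \<le> V (truncated u T v G) n z"
  using assms
proof (induction n arbitrary: z r)
  case 0
  then show ?case using abs_ge_zero order_trans by fastforce
next
  case (Suc n)
  show ?case
  proof (cases "T \<le> height u z")
    case True
    have "z \<in> cube (r + int (Suc n) * B)"
      by (rule cube_later[OF Suc.prems(1)])
    then show ?thesis
      using Suc.prems(2)[of "Suc n" z] V_truncated_above[OF True, of v G "Suc n"] by (simp add: abs_le_iff)
  next
    case False
    obtain i where i: "i \<in> I" "V G (Suc n) z = G z i + V G n (z + i)"
      using V_attained by blast
    have "V G n (z + i) - real n * v - e \<le> V (truncated u T v G) n (z + i)"
      using step_in_cube[OF Suc.prems(1) i(1)]
    proof (rule Suc.IH)
      show "\<bar>V G m w - real m * v\<bar> \<le> e" if "m \<le> n" "w \<in> cube (r + B + int n * B)" for m w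
        using that Suc.prems(2)[of m w] by (simp only: cube_Suc)
    qed
    then show ?thesis
      using V_ge[OF i(1), of "truncated u T v G" z n] i(2) False
      by (simp add: truncated_def[of u T v G z] algebra_simps del: max_total.simps(2))
  qed
qed

text \<open>Take for \<open>m\<close> the step at which an optimal path for the truncated payoffs
  leaves the band, or \<open>n\<close> if it never does; up to then it collects
  \<open>G - v\<close>.\<close>

lemma V_truncated_upper:
  "\<exists>m\<le>n. V (truncated u T v G) n z \<le> V G m z - real m * v"
proof (induction n arbitrary: z)
  case (Suc n)
  show ?case
  proof (cases "T \<le> height u z")
    case True
    then show ?thesis
      using V_truncated_above[of T z v G "Suc n"] by (intro exI[of _ 0]) simp
  next
    case False
    obtain i where i: "i \<in> I" "V (truncated u T v G) (Suc n) z
        = truncated u T v G z i + V (truncated u T v G) n (z + i)"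
      using V_attained by blast
    obtain m where m: "m \<le> n" "V (truncated u T v G) n (z + i) \<le> V G m (z + i) - real m * v"
      using Suc.IH by blast
    show ?thesis
      using m i(2) False V_ge[OF i(1), of G z m]
      by (intro exI[of _ "Suc m"]) (simp add: truncated_def[of u T v G z] algebra_simps del: max_total.simps(2))
  qed
qed simp

text \<open>The lower bound loses \<open>e\<close> twice: for the \<open>n\<close>-step total itself
  and for the tail cut off by truncation.\<close>

lemma V_truncated_abs_le:
  assumes "z \<in> cube r"
    "\<And>m w. m \<le> n \<Longrightarrow> w \<in> cube (r + int n * B) \<Longrightarrow> \<bar>V G m w - real m * v\<bar> \<le> e"
  shows "\<bar>V (truncated u T v G) n z\<bar> \<le> 2 * e"
proof -
  have z: "z \<in> cube (r + int n * B)"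
    by (rule cube_later[OF assms(1)])
  obtain m where "m \<le> n" "V (truncated u T v G) n z \<le> V G m z - real m * v"
    using V_truncated_upper by blast
  moreover have "V G n z - real n * v - e \<le> V (truncated u T v G) n z"
    by (rule V_truncated_lower[OF assms])
  ultimately show ?thesis
    using assms(2)[OF \<open>m \<le> n\<close> z] assms(2)[OF order_refl z] by linarith
qed

section \<open>The band potential and its greedy action\<close>

text \<open>As each step gains height at least 1, this horizon suffices to reach \<open>T\<close>,
  and by \<open>V_truncated_eq\<close> longer ones give the same value.\<close>

definition band_value :: "real \<Rightarrow> (int ^ 'd \<Rightarrow> int ^ 'd \<Rightarrow> real) \<Rightarrow> int \<Rightarrow> int ^ 'd \<Rightarrow> real" where
  "band_value v G T z = V (truncated u T v G) (nat (T - height u z)) z"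

definition band_maximizers :: "real \<Rightarrow> (int ^ 'd \<Rightarrow> int ^ 'd \<Rightarrow> real) \<Rightarrow> int ^ 'd \<Rightarrow> (int ^ 'd) set" where
  "band_maximizers v G z = {i\<in>I. \<forall>j\<in>I.
     G z j + band_value v G (dyadic_above (height u z)) (z + j)
       \<le> G z i + band_value v G (dyadic_above (height u z)) (z + i)}"

text \<open>The choice sees the payoffs only through the finite set of maximisers, which keeps it
  measurable.\<close>

definition band_action :: "real \<Rightarrow> (int ^ 'd \<Rightarrow> int ^ 'd \<Rightarrow> real) \<Rightarrow> int ^ 'd \<Rightarrow> int ^ 'd" where
  "band_action v G z = (SOME i. i \<in> band_maximizers v G z)"

lemma band_action_maximizer: "band_action v G z \<in> band_maximizers v G z"
proof -
  let ?q = "\<lambda>i. G z i + band_value v G (dyadic_above (height u z)) (z + i)"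
  obtain i where "i \<in> I" "?q i = Max (?q ` I)"
  proof -
    have "Max (?q ` I) \<in> ?q ` I"
      using finite_steps steps_nonempty by (intro Max_in) auto
    then show thesis
      using that by (metis (no_types, lifting) imageE)
  qed
  then have "i \<in> band_maximizers v G z"
    using finite_steps by (auto simp: band_maximizers_def)
  then show ?thesis
    unfolding band_action_def by (rule someI)
qed

lemma band_action_step: "band_action v G z \<in> I"
  using band_action_maximizer by (auto simp: band_maximizers_def)

lemma band_value_above: "T \<le> height u z \<Longrightarrow> band_value v G T z = 0"
  by (simp add: band_value_def V_truncated_above)

text \<open>This is the Bellman equation at the greedy action. When the step leaves the band, the
  old potential vanishes at the new state and a new band starts; hence the case distinction, in the
  form used by \<open>band_sum_lower_bound\<close>.\<close>

lemma band_value_action: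
  fixes z v G
  defines "z' \<equiv> z + band_action v G z"
  shows "band_value v G (dyadic_above (height u z)) z = G z (band_action v G z) - v +
    (if dyadic_above (height u z') = dyadic_above (height u z)
     then band_value v G (dyadic_above (height u z')) z' else 0)"
proof -
  define T where "T = dyadic_above (height u z)"
  let ?q = "\<lambda>i. G z i + band_value v G T (z + i)"
  have T: "height u z < T"
    unfolding T_def by (rule less_dyadic_above)
  obtain n where n: "nat (T - height u z) = Suc n"
    using T by (cases "nat (T - height u z)") auto
  \<comment> \<open>A step may gain more than one unit of height, so the remaining horizon
    \<open>n\<close> can exceed the one built into \<open>band_value\<close> at the successor;
    \<open>V_truncated_eq\<close> reconciles them.\<close>
  have fuel: "V (truncated u T v G) n (z + i) = band_value v G T (z + i)" if "i \<in> I" for i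
    unfolding band_value_def using n height_step[OF that] T
    by (intro V_truncated_eq) (auto simp: height_add)
  have "band_value v G T z = Max ((\<lambda>i. truncated u T v G z i + V (truncated u T v G) n (z + i)) ` I)"
    unfolding band_value_def n by simp
  also have "\<dots> = Max ((\<lambda>i. ?q i - v) ` I)"
    using T fuel by (intro arg_cong[where f = Max] image_cong refl) (simp add: truncated_def)
  also have "\<dots> = ?q (band_action v G z) - v"
    using band_action_maximizer[of v G z] finite_steps
    by (intro Max_eqI) (auto simp: band_maximizers_def T_def)
  finally have eq: "band_value v G T z = G z (band_action v G z) - v + band_value v G T z'"
    by (simp add: z'_def)
  have up: "height u z \<le> height u z'"
    using height_step[OF band_action_step[of v G z]] by (simp add: z'_def height_add)
  show ?thesis
  proof (cases "height u z' < T")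
    case True
    then have "dyadic_above (height u z') = T"
      unfolding T_def using up by (intro dyadic_above_eq) auto
    then show ?thesis using eq by (simp add: T_def)
  next
    case False
    then have "dyadic_above (height u z') \<noteq> T"
      using less_dyadic_above[of "height u z'"] by auto
    then show ?thesis using eq False by (simp add: T_def band_value_above)
  qed
qed

lemma path_total_le:
  assumes "\<And>j. b j \<in> I" "\<And>j. s (Suc j) = s j + b j"
  shows "(\<Sum>j<n. G (s j) (b j)) \<le> V G n (s 0)"
  using assms
proof (induction n arbitrary: s b)
  case (Suc n)
  have "(\<Sum>j<n. G (s (Suc j)) (b (Suc j))) \<le> V G n (s (Suc 0))"
    by (rule Suc.IH[of "\<lambda>j. b (Suc j)" "\<lambda>j. s (Suc j)"]) (simp_all add: Suc.prems)
  then have "(\<Sum>j<Suc n. G (s j) (b j)) \<le> G (s 0) (b 0) + V G n (s 0 + b 0)"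
    unfolding sum.lessThan_Suc_shift by (simp add: Suc.prems(2))
  also have "\<dots> \<le> V G (Suc n) (s 0)"
    by (rule V_ge[OF Suc.prems(1)])
  finally show ?case .
qed simp

lemma path_total_attained:
  "\<exists>b. (\<forall>j. b j \<in> I) \<and> (\<Sum>j<n. G (z + (\<Sum>l<j. b l)) (b j)) = V G n z"
proof (induction n arbitrary: z)
  case 0
  obtain i where "i \<in> I" using steps_nonempty by blast
  then show ?case by (intro exI[of _ "\<lambda>_. i"]) simp
next
  case (Suc n)
  obtain i where i: "i \<in> I" "V G (Suc n) z = G z i + V G n (z + i)"
    using V_attained by blast
  obtain b where b: "\<And>j. b j \<in> I" "(\<Sum>j<n. G (z + i + (\<Sum>l<j. b l)) (b j)) = V G n (z + i)"
    using Suc.IH[of "z + i"] by blast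
  define c where "c = case_nat i b"
  have "(\<Sum>l<Suc j. c l) = i + (\<Sum>l<j. b l)" for j
    unfolding sum.lessThan_Suc_shift by (simp add: c_def)
  then have "(\<Sum>j<Suc n. G (z + (\<Sum>l<j. c l)) (c j)) = V G (Suc n) z"
    unfolding sum.lessThan_Suc_shift[of "\<lambda>j. G (z + (\<Sum>l<j. c l)) (c j)"] i(2) b(2)[symmetric]
    by (simp add: c_def add.assoc del: sum.lessThan_Suc)
  moreover have "c j \<in> I" for j
    using i(1) b(1) by (cases j) (auto simp: c_def)
  ultimately show ?case by blast
qed

end

section \<open>The limit value\<close>

text \<open>Clipping the payoffs makes the optimal total bounded on the whole product space, where the
  coordinates are bounded only almost surely.\<close>

definition clip :: "real \<Rightarrow> real \<Rightarrow> real" where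
  "clip C t = max (- C) (min C t)"

lemma clip_abs_le: "0 \<le> C \<Longrightarrow> \<bar>clip C t\<bar> \<le> C"
  by (auto simp: clip_def)

lemma clip_eq: "\<bar>t\<bar> \<le> C \<Longrightarrow> clip C t = t"
  by (auto simp: clip_def)

lemma clip_measurable [measurable]: "clip C \<in> borel_measurable borel"
  unfolding clip_def by measurable

lemma payoff_eq:
  "payoff g n \<omega> z \<sigma> = (\<Sum>j<n. g \<omega> (state_at \<sigma> \<omega> z (Suc j)) (\<sigma> (Suc j) \<omega> z)) / real n"
  unfolding payoff_def using sum.atLeast1_atMost_eq[of "\<lambda>m. g \<omega> (state_at \<sigma> \<omega> z m) (\<sigma> m \<omega> z)" n]
  by simp

section \<open>The payoffs as an independent, translation invariant field\<close>

locale graded_pmdp = pmdp M I g + directed_steps I u B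
  for M :: "'w measure" and I :: "(int ^ 'd) set" and g :: "'w \<Rightarrow> int ^ 'd \<Rightarrow> int ^ 'd \<Rightarrow> real"
    and u :: "int ^ 'd" and B :: int +
  fixes C :: real
  assumes C_pos: "0 < C"
    and g_abs_le: "\<omega> \<in> space M \<Longrightarrow> i \<in> I \<Longrightarrow> \<bar>g \<omega> z i\<bar> \<le> C"
begin

lemma g_measurable: "i \<in> I \<Longrightarrow> (\<lambda>\<omega>. g \<omega> z i) \<in> borel_measurable M"
  using g_indep by (auto simp: indep_vars_def)

lemma V_random_variable [measurable]: "(\<lambda>\<omega>. V (g \<omega>) n z) \<in> borel_measurable M"
  by (intro V_measurable g_measurable)

definition law :: "real measure" where
  "law = distr M borel (\<lambda>\<omega>. g \<omega> 0 (SOME i. i \<in> I))"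

lemma some_step: "(SOME i. i \<in> I) \<in> I"
  using I_nonempty by (simp add: some_in_eq)

lemma distr_g: "i \<in> I \<Longrightarrow> distr M borel (\<lambda>\<omega>. g \<omega> z i) = law"
  unfolding law_def using g_ident_distr some_step by blast

lemma prob_space_law: "prob_space law"
  unfolding law_def by (intro prob_space_distr g_measurable some_step)

lemma sets_law [measurable_cong]: "sets law = sets borel"
  by (simp add: law_def)

text \<open>Coordinates are relative to \<open>z\<close>, so that the environments seen from
  different starts live on one product space and can be compared in law.\<close>

definition env :: "int ^ 'd \<Rightarrow> ((int ^ 'd) \<times> (int ^ 'd)) set \<Rightarrow> 'w \<Rightarrow> (int ^ 'd) \<times> (int ^ 'd) \<Rightarrow> real" where
  "env z J \<omega> = (\<lambda>(w, i)\<in>J. g \<omega> (z + w) i)"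

lemma env_measurable:
  assumes "J \<subseteq> UNIV \<times> I"
  shows "env z J \<in> M \<rightarrow>\<^sub>M PiM J (\<lambda>_. law)"
  unfolding env_def
  by (rule measurable_restrict) (use assms in \<open>auto intro!: g_measurable simp: measurable_cong_sets[OF refl sets_law]\<close>)

text \<open>The translated index set carries independent payoffs with common law, hence a product
  measure; a product of equal laws is unchanged under reindexing by the injection
  \<open>\<tau>\<close>.\<close>

lemma distr_env:
  assumes J: "J \<subseteq> UNIV \<times> I" "J \<noteq> {}"
  shows "distr M (PiM J (\<lambda>_. law)) (env z J) = PiM J (\<lambda>_. law)"
proof -
  define \<tau> where "\<tau> = (\<lambda>(w, i). (z + w, i :: int ^ 'd))"
  define K where "K = \<tau> ` J"
  have K: "K \<subseteq> UNIV \<times> I" "K \<noteq> {}"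
    using J by (auto simp: K_def \<tau>_def)
  have "indep_vars (\<lambda>_. borel) (\<lambda>(z, i) \<omega>. g \<omega> z i) K"
    by (rule indep_vars_subset[OF g_indep K(1)])
  then have "distr M (PiM K (\<lambda>_. borel)) (\<lambda>\<omega>. \<lambda>k\<in>K. (case k of (z, i) \<Rightarrow> \<lambda>\<omega>. g \<omega> z i) \<omega>)
      = PiM K (\<lambda>k. distr M borel (case k of (z, i) \<Rightarrow> \<lambda>\<omega>. g \<omega> z i))"
    using K by (subst (asm) indep_vars_iff_distr_eq_PiM') (auto intro!: g_measurable)
  also have "\<dots> = PiM K (\<lambda>_. law)"
    using K(1) by (intro PiM_cong refl) (auto intro!: distr_g)
  also have "distr M (PiM K (\<lambda>_. borel)) (\<lambda>\<omega>. \<lambda>k\<in>K. (case k of (z, i) \<Rightarrow> \<lambda>\<omega>. g \<omega> z i) \<omega>)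
      = distr M (PiM K (\<lambda>_. law)) (env 0 K)"
    by (intro distr_cong sets_PiM_cong refl) (auto simp: sets_law env_def fun_eq_iff restrict_def)
  finally have eqK: "distr M (PiM K (\<lambda>_. law)) (env 0 K) = PiM K (\<lambda>_. law)" .
  have "PiM J (\<lambda>_. law) = distr (PiM K (\<lambda>_. law)) (PiM J (\<lambda>_. law)) (\<lambda>x. \<lambda>j\<in>J. x (\<tau> j))"
    by (rule distr_PiM_reindex[symmetric, where M = "\<lambda>_. law"])
      (auto simp: prob_space_law K_def \<tau>_def inj_on_def)
  also have "\<dots> = distr (distr M (PiM K (\<lambda>_. law)) (env 0 K)) (PiM J (\<lambda>_. law)) (\<lambda>x. \<lambda>j\<in>J. x (\<tau> j))"
    by (simp only: eqK)
  also have "\<dots> = distr M (PiM J (\<lambda>_. law)) ((\<lambda>x. \<lambda>j\<in>J. x (\<tau> j)) \<circ> env 0 K)"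
    by (intro distr_distr env_measurable K measurable_restrict measurable_component_singleton)
      (auto simp: K_def)
  also have "(\<lambda>x. \<lambda>j\<in>J. x (\<tau> j)) \<circ> env 0 K = env z J"
    by (auto simp: fun_eq_iff env_def restrict_def K_def \<tau>_def)
  finally show ?thesis by simp
qed

definition window :: "nat \<Rightarrow> ((int ^ 'd) \<times> (int ^ 'd)) set" where
  "window n = cube (int n * B) \<times> I"

text \<open>The value 0 off the window is a filler that no path of \<open>n\<close> steps from the
  origin meets.\<close>

definition window_total :: "nat \<Rightarrow> ((int ^ 'd) \<times> (int ^ 'd) \<Rightarrow> real) \<Rightarrow> real" where
  "window_total n x = V (\<lambda>w i. if (w, i) \<in> window n then clip C (x (w, i)) else 0) n 0"

lemma window: "window n \<subseteq> UNIV \<times> I" "window n \<noteq> {}" "finite (window n)"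
  using zero_in_cube[of "int n * B"] B_nonneg I_nonempty I_finite by (auto simp: window_def)

lemma window_total_measurable [measurable]:
  "window_total n \<in> borel_measurable (PiM (window n) (\<lambda>_. law))"
  unfolding window_total_def
proof (rule V_measurable)
  fix w i
  show "(\<lambda>x. if (w, i) \<in> window n then clip C (x (w, i)) else 0) \<in> borel_measurable (PiM (window n) (\<lambda>_. law))"
  proof (cases "(w, i) \<in> window n")
    case True
    then have "(\<lambda>x. x (w, i)) \<in> PiM (window n) (\<lambda>_. law) \<rightarrow>\<^sub>M law"
      by (rule measurable_component_singleton)
    then have "(\<lambda>x. x (w, i)) \<in> borel_measurable (PiM (window n) (\<lambda>_. law))"
      by (simp add: measurable_cong_sets[OF refl sets_law])
    then show ?thesis
      using True by simp
  qed simp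
qed

lemma window_total_env:
  assumes "\<omega> \<in> space M"
  shows "window_total n (env z (window n) \<omega>) = V (g \<omega>) n z"
proof -
  have "window_total n (env z (window n) \<omega>) = V (\<lambda>w. g \<omega> (z + w)) n 0"
    unfolding window_total_def
    by (rule V_cong[of _ 0])
       (use assms g_abs_le in \<open>auto simp: zero_in_cube window_def env_def clip_eq\<close>)
  then show ?thesis
    using V_shift[of "g \<omega>" n z 0] by simp
qed

lemma window_total_abs_le: "\<bar>window_total n x\<bar> \<le> C * real n"
  unfolding window_total_def using C_pos
  by (intro V_abs_le) (auto simp: clip_abs_le)

lemma window_total_change_level:
  assumes "\<And>j. j \<in> window n \<Longrightarrow> height u (fst j) \<noteq> k \<Longrightarrow> x j = y j"
  shows "\<bar>window_total n x - window_total n y\<bar> \<le> 2 * C"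
proof -
  have "\<bar>clip C s - clip C t\<bar> \<le> 2 * C" for s t
    using clip_abs_le[of C s] clip_abs_le[of C t] C_pos by linarith
  then have "\<bar>window_total n x - window_total n y\<bar> \<le> (if height u 0 \<le> k then 2 * C else 0)"
    unfolding window_total_def using assms C_pos by (intro V_change_level) auto
  then show ?thesis
    using C_pos by (simp split: if_splits)
qed

section \<open>Concentration of the optimal totals\<close>

definition mean_total :: "nat \<Rightarrow> real" where
  "mean_total n = expectation (\<lambda>\<omega>. V (g \<omega>) n 0)"

text \<open>Translation invariance enters here: the right-hand side does not mention
  \<open>z\<close>, so \<open>mean_total\<close> is the mean from every start.\<close>

lemma expectation_V:
  fixes \<phi> :: "real \<Rightarrow> real"
  assumes "\<phi> \<in> borel_measurable borel"
  shows "expectation (\<lambda>\<omega>. \<phi> (V (g \<omega>) n z)) = (\<integral>x. \<phi> (window_total n x) \<partial>PiM (window n) (\<lambda>_. law))"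
proof -
  have "(\<integral>x. \<phi> (window_total n x) \<partial>PiM (window n) (\<lambda>_. law))
      = (\<integral>x. \<phi> (window_total n x) \<partial>distr M (PiM (window n) (\<lambda>_. law)) (env z (window n)))"
    by (simp add: distr_env window)
  also have "\<dots> = expectation (\<lambda>\<omega>. \<phi> (window_total n (env z (window n) \<omega>)))"
    by (rule Bochner_Integration.integral_distr)
      (auto intro!: env_measurable window measurable_compose[OF window_total_measurable assms])
  also have "\<dots> = expectation (\<lambda>\<omega>. \<phi> (V (g \<omega>) n z))"
    by (intro Bochner_Integration.integral_cong refl) (simp add: window_total_env)
  finally show ?thesis by simp
qed

text \<open>A bound, per step of the horizon, on the number of height levels met by the
  window.\<close>

definition level_density :: real where
  "level_density = 2 * of_int ((\<Sum>k\<in>UNIV. \<bar>u $ k\<bar>) * B) + 1"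

lemma level_density_pos: "0 < level_density"
  unfolding level_density_def using B_nonneg by (intro add_nonneg_pos mult_nonneg_nonneg) (auto intro: sum_nonneg)

text \<open>Each height level is one block: it changes the total by at most \<open>2 * C\<close>,
  and there are \<open>O(n)\<close> levels. Writing the exponent with \<open>n\<close> instead of
  \<open>m\<close> gives one bound for all horizons up to \<open>n\<close>.\<close>

lemma V_mgf:
  assumes "m \<le> n" "1 \<le> n"
  shows "expectation (\<lambda>\<omega>. exp (l * (V (g \<omega>) m z - mean_total m)))
    \<le> exp (l\<^sup>2 * (4 * C\<^sup>2 * level_density * real n) / 2)"
proof -
  let ?P = "PiM (window m) (\<lambda>_. law)"
  define H where "H = (\<Sum>k\<in>UNIV. \<bar>u $ k\<bar>) * (int m * B)"
  \<comment> \<open>The parameter \<open>l\<close> is absorbed into \<open>f\<close>, whose block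
    differences become \<open>\<bar>l\<bar> * (2 * C)\<close>.\<close>
  define f where "f x = l * window_total m x" for x
  have H: "0 \<le> H"
    unfolding H_def using B_nonneg by (intro mult_nonneg_nonneg sum_nonneg) auto
  have mean: "(\<integral>x. f x \<partial>?P) = l * mean_total m"
    using expectation_V[of "\<lambda>t. t" m 0] by (simp add: f_def mean_total_def)
  have "expectation (\<lambda>\<omega>. exp (l * (V (g \<omega>) m z - mean_total m)))
      = (\<integral>x. exp (l * (window_total m x - mean_total m)) \<partial>?P)"
    by (rule expectation_V) measurable
  also have "\<dots> = (\<integral>x. exp (f x - (\<integral>y. f y \<partial>?P)) \<partial>?P)"
    unfolding mean by (simp add: f_def right_diff_distrib)
  also have "\<dots> \<le> exp ((\<bar>l\<bar> * (2 * C))\<^sup>2 * real (card {-H..H}) / 2)"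
  proof (rule bounded_difference_mgf)
    show "(\<lambda>j. height u (fst j)) ` window m \<subseteq> {-H..H}"
      using height_cube_le[of _ "int m * B" u] by (force simp: window_def H_def abs_le_iff)
    show "f \<in> borel_measurable ?P"
      unfolding f_def by measurable
    show "\<bar>f x\<bar> \<le> \<bar>l\<bar> * (C * real m)" for x
      unfolding f_def abs_mult by (intro mult_left_mono window_total_abs_le) auto
    show "\<bar>f x - f y\<bar> \<le> \<bar>l\<bar> * (2 * C)"
      if "\<And>j. j \<in> window m \<Longrightarrow> height u (fst j) \<noteq> k \<Longrightarrow> x j = y j" for x y k
      unfolding f_def right_diff_distrib[symmetric] abs_mult using that
      by (intro mult_left_mono window_total_change_level[of _ k]) auto
  qed (auto simp: prob_space_law window)
  also have "\<dots> \<le> exp (l\<^sup>2 * (4 * C\<^sup>2 * level_density * real n) / 2)"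
  proof -
    have "real (card {-H..H}) = 2 * of_int ((\<Sum>k\<in>UNIV. \<bar>u $ k\<bar>) * B) * real m + 1"
    proof -
      have "real (card {-H..H}) = 2 * of_int H + 1"
        using H by simp
      then show ?thesis by (simp add: H_def mult_ac)
    qed
    also have "\<dots> \<le> 2 * of_int ((\<Sum>k\<in>UNIV. \<bar>u $ k\<bar>) * B) * real n + 1 * real n"
      using assms B_nonneg
      by (intro add_mono mult_left_mono mult_nonneg_nonneg) (auto intro!: mult_nonneg_nonneg sum_nonneg)
    finally have "real (card {-H..H}) \<le> level_density * real n"
      by (simp add: level_density_def distrib_right)
    then have "(\<bar>l\<bar> * (2 * C))\<^sup>2 * real (card {-H..H}) \<le> (\<bar>l\<bar> * (2 * C))\<^sup>2 * (level_density * real n)"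
      by (intro mult_left_mono) auto
    then show ?thesis
      by (simp add: power_mult_distrib algebra_simps)
  qed
  finally show ?thesis .
qed

lemma V_abs_le_C: "\<omega> \<in> space M \<Longrightarrow> \<bar>V (g \<omega>) n z\<bar> \<le> C * real n"
  by (intro V_abs_le g_abs_le)

lemma V_tail:
  assumes "m \<le> n" "1 \<le> n" "0 < t"
  shows "prob {\<omega>\<in>space M. t \<le> \<bar>V (g \<omega>) m z - mean_total m\<bar>}
    \<le> 2 * exp (- t\<^sup>2 / (2 * (4 * C\<^sup>2 * level_density * real n)))"
proof (rule subgaussian_tail)
  show "integrable M (\<lambda>\<omega>. exp (l * (V (g \<omega>) m z - mean_total m)))" for l
  proof (rule integrable_const_bound)
    show "AE \<omega> in M. norm (exp (l * (V (g \<omega>) m z - mean_total m)))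
        \<le> exp (\<bar>l\<bar> * (C * real m + \<bar>mean_total m\<bar>))"
    proof (rule AE_I2)
      fix \<omega> assume "\<omega> \<in> space M"
      then have "\<bar>V (g \<omega>) m z - mean_total m\<bar> \<le> C * real m + \<bar>mean_total m\<bar>"
        using V_abs_le_C[of \<omega> m z] by linarith
      then have "\<bar>l\<bar> * \<bar>V (g \<omega>) m z - mean_total m\<bar> \<le> \<bar>l\<bar> * (C * real m + \<bar>mean_total m\<bar>)"
        by (intro mult_left_mono) auto
      then show "norm (exp (l * (V (g \<omega>) m z - mean_total m)))
        \<le> exp (\<bar>l\<bar> * (C * real m + \<bar>mean_total m\<bar>))"
        by (simp flip: abs_mult)
    qed
  qed measurable
qed (use V_mgf assms C_pos level_density_pos in auto)

text \<open>Radius \<open>n\<^sup>2\<close> leaves room for every state reachable within \<open>O(n)\<close> steps of a fixed start.\<close>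

definition bad :: "nat \<Rightarrow> 'w set" where
  "bad n = (\<Union>z\<in>cube ((int n)\<^sup>2). \<Union>m\<in>{..n}.
     {\<omega>\<in>space M. real n powr (3/4) \<le> \<bar>V (g \<omega>) m z - mean_total m\<bar>})"

lemma bad_sets [measurable]: "bad n \<in> sets M"
  unfolding bad_def by (intro sets.finite_UN) auto

text \<open>A union bound over starts and horizons. The squared threshold
  \<open>n powr (3/2)\<close> against a variance proxy of order \<open>n\<close> leaves
  \<open>n powr (1/2)\<close> in the exponent.\<close>

lemma prob_bad_le:
  assumes "1 \<le> n"
  shows "prob (bad n) \<le> real (nat (2 * (int n)\<^sup>2 + 1) ^ CARD('d)) * (real n + 1) *
    (2 * exp (- (1 / (8 * C\<^sup>2 * level_density)) * real n powr (1/2)))"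
proof -
  define e where "e = 2 * exp (- (1 / (8 * C\<^sup>2 * level_density)) * real n powr (1/2))"
  let ?E = "\<lambda>z m. {\<omega>\<in>space M. real n powr (3/4) \<le> \<bar>V (g \<omega>) m z - mean_total m\<bar>}"
  have sq: "(real n powr (3/4))\<^sup>2 / real n = real n powr (1/2)"
  proof -
    have "(real n powr (3/4))\<^sup>2 = real n powr (3/2)"
      using assms by (simp add: power2_eq_square flip: powr_add)
    also have "\<dots> / real n = real n powr (3/2 - 1)"
      using assms by (subst powr_diff) simp
    finally show ?thesis by simp
  qed
  have E: "prob (?E z m) \<le> e" if "m \<le> n" for z m
  proof -
    have "prob (?E z m) \<le> 2 * exp (- (real n powr (3/4))\<^sup>2 / (2 * (4 * C\<^sup>2 * level_density * real n)))"
      using assms that by (intro V_tail) auto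
    also have "- (real n powr (3/4))\<^sup>2 / (2 * (4 * C\<^sup>2 * level_density * real n))
        = - (1 / (8 * C\<^sup>2 * level_density)) * ((real n powr (3/4))\<^sup>2 / real n)"
      by simp
    finally show ?thesis
      by (simp only: sq e_def)
  qed
  have "prob (bad n) \<le> (\<Sum>z\<in>cube ((int n)\<^sup>2). prob (\<Union>m\<in>{..n}. ?E z m))"
    unfolding bad_def by (intro measure_UNION_le) auto
  also have "\<dots> \<le> (\<Sum>z\<in>(cube ((int n)\<^sup>2) :: (int ^ 'd) set). \<Sum>m\<in>{..n}. prob (?E z m))"
    by (intro sum_mono measure_UNION_le) auto
  also have "\<dots> \<le> (\<Sum>z\<in>(cube ((int n)\<^sup>2) :: (int ^ 'd) set). \<Sum>m\<in>{..n}. e)"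
    using E by (intro sum_mono) auto
  also have "\<dots> = real (card (cube ((int n)\<^sup>2) :: (int ^ 'd) set)) * ((real n + 1) * e)"
    by (simp add: add.commute)
  also have "\<dots> \<le> real (nat (2 * (int n)\<^sup>2 + 1) ^ CARD('d)) * ((real n + 1) * e)"
    by (intro mult_right_mono of_nat_mono card_cube_le) (simp add: e_def)
  finally show ?thesis
    by (simp add: e_def mult.assoc)
qed

lemma summable_prob_bad: "summable (\<lambda>n. prob (bad n))"
proof (rule summable_comparison_test'[OF summable_poly_stretched_exp, of _ 1])
  show "0 < 1 / (8 * C\<^sup>2 * level_density)"
    using C_pos level_density_pos by simp
  show "norm (prob (bad n)) \<le> real (nat (2 * (int n)\<^sup>2 + 1) ^ CARD('d)) * (real n + 1) *
    (2 * exp (- (1 / (8 * C\<^sup>2 * level_density)) * real n powr (1/2)))" if "1 \<le> n" for n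
    using prob_bad_le[OF that] by simp
qed

lemma eventually_not_bad: "AE \<omega> in M. \<forall>\<^sub>F n in sequentially. \<omega> \<in> space M - bad n"
  by (intro borel_cantelli_AE1 summable_prob_bad) (auto simp: emeasure_eq_measure)

text \<open>Once the bad event has probability below 1, some good \<open>\<omega>\<close> exists,
  and the inequality between deterministic means can be read off at that one point. Small
  \<open>p + q\<close> are absorbed into the constant.\<close>

lemma mean_total_near_additive:
  "\<exists>A. \<forall>p q. \<bar>mean_total (p + q) - mean_total p - mean_total q\<bar> \<le> A * real (p + q) powr (3/4)"
proof -
  have "(\<lambda>n. prob (bad n)) \<longlonglongrightarrow> 0"
    by (rule summable_LIMSEQ_zero[OF summable_prob_bad])
  then have "\<forall>\<^sub>F n in sequentially. prob (bad n) < 1"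
    by (rule order_tendstoD) simp
  \<comment> \<open>\<open>nat B \<le> n\<close> ensures \<open>p * B \<le> n^2\<close>, so the
    states reached after \<open>p\<close> steps stay in the cube controlled by
    \<open>bad n\<close>.\<close>
  then have "\<forall>\<^sub>F n in sequentially. prob (bad n) < 1 \<and> nat B \<le> n"
    using eventually_ge_at_top by (rule eventually_conj)
  then obtain N where N: "\<And>n. n \<ge> N \<Longrightarrow> prob (bad n) < 1 \<and> nat B \<le> n"
    unfolding eventually_sequentially by blast
  have large: "\<bar>mean_total (p + q) - mean_total p - mean_total q\<bar> \<le> 3 * real (p + q) powr (3/4)"
    if "N \<le> p + q" for p q
  proof -
    define n where "n = p + q"
    define t where "t = real n powr (3/4)"
    have "prob (bad n) < 1" "B \<le> int n"
      using N[of n] that by (auto simp: n_def nat_le_iff)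
    then have "bad n \<noteq> space M"
      using prob_space by auto
    then obtain \<omega> where \<omega>: "\<omega> \<in> space M" "\<omega> \<notin> bad n"
      using sets.sets_into_space[OF bad_sets] by blast
    have good: "\<bar>V (g \<omega>) m z - mean_total m\<bar> \<le> t" if "m \<le> n" "z \<in> cube ((int n)\<^sup>2)" for m z
      using \<omega> that by (force simp: bad_def t_def not_le less_imp_le)
    have 0: "(0 :: int ^ 'd) \<in> cube ((int n)\<^sup>2)"
      by (simp add: zero_in_cube)
    have sub: "cube (0 + int p * B) \<subseteq> (cube ((int n)\<^sup>2) :: (int ^ 'd) set)"
      unfolding power2_eq_square using \<open>B \<le> int n\<close> B_nonneg
      by (intro cube_mono) (simp add: mult_mono n_def)
    have "\<bar>V (g \<omega>) (p + q) 0 - V (g \<omega>) p 0 - mean_total q\<bar> \<le> t"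
      using sub by (intro V_split[of _ 0] good) (auto simp: zero_in_cube n_def)
    moreover have "\<bar>V (g \<omega>) (p + q) 0 - mean_total (p + q)\<bar> \<le> t" "\<bar>V (g \<omega>) p 0 - mean_total p\<bar> \<le> t"
      by (auto intro!: good 0 simp: n_def)
    ultimately show ?thesis
      by (fold n_def, fold t_def) (simp add: n_def abs_le_iff)
  qed
  have mean_le: "\<bar>mean_total n\<bar> \<le> C * real n" for n
  proof -
    have "\<bar>mean_total n\<bar> \<le> expectation (\<lambda>\<omega>. \<bar>V (g \<omega>) n 0\<bar>)"
      unfolding mean_total_def by (rule integral_abs_bound)
    also have "\<dots> \<le> expectation (\<lambda>\<omega>. C * real n)"
      by (intro integral_mono integrable_const_bound[of _ "C * real n"] AE_I2)
        (use C_pos in \<open>auto simp: V_abs_le_C\<close>)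
    finally show ?thesis by (simp add: prob_space)
  qed
  \<comment> \<open>The crude bound \<open>2 * C * (p + q)\<close> suffices, as
    \<open>real (p + q) powr (3/4)\<close> is at least 1 unless the sum is 0.\<close>
  have small: "\<bar>mean_total (p + q) - mean_total p - mean_total q\<bar> \<le> 2 * C * real N * real (p + q) powr (3/4)"
    if "p + q < N" for p q
  proof (cases "p + q = 0")
    case True
    then show ?thesis using mean_le[of 0] by simp
  next
    case False
    have "\<bar>mean_total (p + q) - mean_total p - mean_total q\<bar> \<le> 2 * C * real (p + q)"
      using mean_le[of "p + q"] mean_le[of p] mean_le[of q] by (simp add: abs_le_iff algebra_simps)
    also have "\<dots> \<le> 2 * C * real N * 1"
      using that C_pos by simp
    also have "\<dots> \<le> 2 * C * real N * real (p + q) powr (3/4)"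
      using False C_pos by (intro mult_left_mono ge_one_powr_ge_zero) auto
    finally show ?thesis .
  qed
  have "\<bar>mean_total (p + q) - mean_total p - mean_total q\<bar> \<le> (3 + 2 * C * real N) * real (p + q) powr (3/4)" for p q
  proof (cases "N \<le> p + q")
    case True
    have "0 \<le> 2 * C * real N * real (p + q) powr (3/4)"
      using C_pos by simp
    then show ?thesis using large[OF True] by (simp add: distrib_right)
  next
    case False
    have "0 \<le> 3 * real (p + q) powr (3/4)" by simp
    then show ?thesis using small[of p q] False unfolding distrib_right by linarith
  qed
  then show ?thesis by blast
qed

section \<open>Uniform closeness and the limit value\<close>

text \<open>On this event the values and the strategy are analysed pathwise. The error is measured
  against \<open>n\<close>, not \<open>m\<close>, so that short horizons are covered too.\<close>

definition uniformly_close :: "real \<Rightarrow> 'w \<Rightarrow> bool" where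
  "uniformly_close v \<omega> \<longleftrightarrow> (\<forall>\<delta>>0. \<forall>\<^sub>F n in sequentially. \<forall>m\<le>n. \<forall>z\<in>cube ((int n)\<^sup>2).
     \<bar>V (g \<omega>) m z - real m * v\<bar> \<le> \<delta> * real n)"

lemma AE_uniformly_close: "\<exists>v. AE \<omega> in M. uniformly_close v \<omega>"
proof -
  obtain A where "\<And>p q. \<bar>mean_total (p + q) - mean_total p - mean_total q\<bar> \<le> A * real (p + q) powr (3/4)"
    using mean_total_near_additive by blast
  from near_additive_limit[OF this] obtain v A' where
    v: "\<And>n. \<bar>mean_total n - real n * v\<bar> \<le> A' * real n powr (3/4)" by blast
  have A': "0 \<le> A'"
    using order_trans[OF abs_ge_zero v[of 1]] by simp
  have "AE \<omega> in M. uniformly_close v \<omega>"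
    using eventually_not_bad
  proof eventually_elim
    case (elim \<omega>)
    show "uniformly_close v \<omega>"
      unfolding uniformly_close_def
    proof (intro allI impI)
      fix \<delta> :: real assume "0 < \<delta>"
      then have "\<forall>\<^sub>F n in sequentially. (1 + A') * real n powr (3/4) \<le> \<delta> * real n"
        using A' by real_asymp
      with elim show "\<forall>\<^sub>F n in sequentially. \<forall>m\<le>n. \<forall>z\<in>cube ((int n)\<^sup>2).
          \<bar>V (g \<omega>) m z - real m * v\<bar> \<le> \<delta> * real n"
      proof eventually_elim
        case (elim n)
        show ?case
        proof (intro allI impI ballI)
          fix m and z :: "int ^ 'd" assume mz: "m \<le> n" "z \<in> cube ((int n)\<^sup>2)"
          have "\<bar>V (g \<omega>) m z - mean_total m\<bar> \<le> real n powr (3/4)"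
            using elim(1) mz by (force simp: bad_def not_le less_imp_le)
          moreover have "A' * real m powr (3/4) \<le> A' * real n powr (3/4)"
            using A' mz by (intro mult_left_mono powr_mono2) auto
          ultimately show "\<bar>V (g \<omega>) m z - real m * v\<bar> \<le> \<delta> * real n"
            using v[of m] elim(2) by (simp add: distrib_right abs_le_iff)
        qed
      qed
    qed
  qed
  then show ?thesis by blast
qed

lemma payoff_le:
  assumes "\<sigma> \<in> strategies M I g" "\<omega> \<in> space M"
  shows "payoff g n \<omega> z \<sigma> \<le> V (g \<omega>) n z / real n"
proof -
  have "(\<Sum>j<n. g \<omega> (state_at \<sigma> \<omega> z (Suc j)) (\<sigma> (Suc j) \<omega> z)) \<le> V (g \<omega>) n (state_at \<sigma> \<omega> z (Suc 0))"
    by (rule path_total_le) (simp_all add: strategy_action[OF assms(1) _ assms(2)])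
  then show ?thesis
    unfolding payoff_eq by (simp add: divide_right_mono)
qed

lemma stage_value_eq:
  assumes "\<omega> \<in> space M"
  shows "stage_value M I g n \<omega> z = V (g \<omega>) n z / real n"
  unfolding stage_value_def
proof (rule Max_eqI)
  show "finite (payoff g n \<omega> z ` strategies M I g)"
    by (rule finite_payoffs[OF assms])
  show "y \<le> V (g \<omega>) n z / real n" if "y \<in> payoff g n \<omega> z ` strategies M I g" for y
    using that payoff_le assms by auto
  obtain b where b: "\<And>j. b j \<in> I" "(\<Sum>j<n. g \<omega> (z + (\<Sum>l<j. b l)) (b j)) = V (g \<omega>) n z"
    using path_total_attained by blast
  \<comment> \<open>For fixed \<open>\<omega>\<close> and \<open>z\<close> a strategy ignoring both
    attains the maximum, so its measurability is immediate. Stages start at 1 and \<open>b\<close>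
    at 0, hence \<open>m - 1\<close>.\<close>
  define \<sigma> where "\<sigma> = (\<lambda>m (_::'w) (_::int ^ 'd). b (m - 1))"
  have "\<sigma> \<in> strategies M I g"
    using b(1) by (auto simp: \<sigma>_def strategies_def)
  moreover have "state_at \<sigma> \<omega> z (Suc j) = z + (\<Sum>l<j. b l)" for j
    by (induction j) (auto simp: \<sigma>_def add.assoc)
  then have "payoff g n \<omega> z \<sigma> = V (g \<omega>) n z / real n"
    unfolding payoff_eq b(2)[symmetric] by (simp add: \<sigma>_def)
  ultimately show "V (g \<omega>) n z / real n \<in> payoff g n \<omega> z ` strategies M I g"
    by (metis imageI)
qed

lemma uniformly_closeD:
  assumes "uniformly_close v \<omega>" "0 < \<delta>"
  shows "\<forall>\<^sub>F n in sequentially. \<forall>m\<le>n. \<forall>z\<in>cube ((int n)\<^sup>2).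
     \<bar>V (g \<omega>) m z - real m * v\<bar> \<le> \<delta> * real n"
  using assms unfolding uniformly_close_def by blast

lemma uniformly_close_limit:
  assumes "uniformly_close v \<omega>"
  shows "(\<lambda>n. V (g \<omega>) n z / real n) \<longlonglongrightarrow> v"
proof (rule tendstoI)
  fix e :: real assume "0 < e"
  obtain r where r: "z \<in> cube r" using cube_exhausts by blast
  have "\<forall>\<^sub>F n in sequentially. \<forall>m\<le>n. \<forall>z\<in>cube ((int n)\<^sup>2).
     \<bar>V (g \<omega>) m z - real m * v\<bar> \<le> e / 2 * real n"
    using \<open>0 < e\<close> by (intro uniformly_closeD[OF assms]) simp
  then show "\<forall>\<^sub>F n in sequentially. dist (V (g \<omega>) n z / real n) v < e"
    using eventually_ge_at_top[of "max 1 (nat r)"]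
  proof eventually_elim
    case (elim n)
    have "r \<le> int n"
      using elim(2) by auto
    also have "int n \<le> (int n)\<^sup>2"
      using elim(2) by (simp add: power2_eq_square)
    finally have "z \<in> cube ((int n)\<^sup>2)"
      using r cube_mono by blast
    then have "\<bar>V (g \<omega>) n z - real n * v\<bar> \<le> e / 2 * real n"
      using elim(1) by blast
    moreover have "V (g \<omega>) n z / real n - v = (V (g \<omega>) n z - real n * v) / real n"
      using elim(2) by (simp add: field_simps)
    ultimately have "\<bar>V (g \<omega>) n z / real n - v\<bar> \<le> e / 2"
      using elim(2) by (simp add: field_simps)
    then show ?case
      using \<open>0 < e\<close> by (simp add: dist_real_def)
  qed
qed

lemma limit_value_eq:
  assumes "AE \<omega> in M. uniformly_close v \<omega>"
  shows "limit_value M I g = v"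
  unfolding limit_value_def
proof (rule the_equality)
  show lim: "\<forall>z. AE \<omega> in M. (\<lambda>n. stage_value M I g n \<omega> z) \<longlonglongrightarrow> v"
  proof
    fix z
    show "AE \<omega> in M. (\<lambda>n. stage_value M I g n \<omega> z) \<longlonglongrightarrow> v"
      using assms AE_space
      by eventually_elim (simp add: stage_value_eq uniformly_close_limit)
  qed
  fix v' assume "\<forall>z. AE \<omega> in M. (\<lambda>n. stage_value M I g n \<omega> z) \<longlonglongrightarrow> v'"
  then have "AE \<omega> in M. (\<lambda>n. stage_value M I g n \<omega> 0) \<longlonglongrightarrow> v'" by blast
  moreover have "AE \<omega> in M. (\<lambda>n. stage_value M I g n \<omega> 0) \<longlonglongrightarrow> v" using lim by blast
  ultimately have "AE \<omega> in M. v' = v"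
    by eventually_elim (rule LIMSEQ_unique)
  then show "v' = v" by simp
qed

section \<open>The stationary strategy\<close>

definition visit :: "real \<Rightarrow> 'w \<Rightarrow> int ^ 'd \<Rightarrow> nat \<Rightarrow> int ^ 'd" where
  "visit v \<omega> z j = ((\<lambda>w. w + band_action v (g \<omega>) w) ^^ j) z"

text \<open>A strategy is given only the initial state, so the play is recomputed from it;
  \<open>visit\<close> counts from 0 and stages from 1.\<close>

definition band_strategy :: "real \<Rightarrow> nat \<Rightarrow> 'w \<Rightarrow> int ^ 'd \<Rightarrow> int ^ 'd" where
  "band_strategy v m \<omega> z = band_action v (g \<omega>) (visit v \<omega> z (m - 1))"

lemma visit_0 [simp]: "visit v \<omega> z 0 = z"
  by (simp add: visit_def)

lemma visit_Suc: "visit v \<omega> z (Suc j) = visit v \<omega> z j + band_action v (g \<omega>) (visit v \<omega> z j)"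
  by (simp add: visit_def)

lemma state_at_band_strategy: "state_at (band_strategy v) \<omega> z (Suc j) = visit v \<omega> z j"
  by (induction j) (auto simp: visit_Suc band_strategy_def)

lemma stationary_band_strategy: "stationary M I (band_strategy v)"
  unfolding stationary_def
proof (intro exI[of _ "\<lambda>\<omega>. band_action v (g \<omega>)"] conjI ballI allI impI)
  fix m :: nat and \<omega> z assume "1 \<le> m"
  then obtain j where "m = Suc j" by (cases m) auto
  then show "band_strategy v m \<omega> z = band_action v (g \<omega>) (state_at (band_strategy v) \<omega> z m)"
    by (simp only: state_at_band_strategy) (simp add: band_strategy_def)
qed (rule band_action_step)

section \<open>Measurability of the band strategy\<close>

lemma space_F_all: "space (F_all M I g) = space M"
  by (simp add: F_all_def space_measure_of_conv)

lemma g_measurable_F_all: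
  assumes "i \<in> I"
  shows "(\<lambda>\<omega>. g \<omega> z i) \<in> borel_measurable (F_all M I g)"
proof (rule measurableI)
  fix A :: "real set" assume "A \<in> sets borel"
  then show "(\<lambda>\<omega>. g \<omega> z i) -` A \<inter> space (F_all M I g) \<in> sets (F_all M I g)"
    unfolding space_F_all using assms unfolding F_all_def by (intro in_measure_of) auto
qed simp

lemma band_value_measurable:
  "(\<lambda>\<omega>. band_value v (g \<omega>) T z) \<in> borel_measurable (F_all M I g)"
  unfolding band_value_def truncated_def
proof (rule V_measurable)
  fix w i assume "i \<in> I"
  then show "(\<lambda>\<omega>. if height u w < T then g \<omega> w i - v else 0) \<in> borel_measurable (F_all M I g)"
    by (cases "height u w < T") (simp_all add: g_measurable_F_all borel_measurable_diff)
qed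

text \<open>The choice factors through the set of maximisers, which takes finitely many values, each
  on an event given by finitely many inequalities between measurable functions.\<close>

lemma band_action_measurable:
  "(\<lambda>\<omega>. band_action v (g \<omega>) z) \<in> F_all M I g \<rightarrow>\<^sub>M count_space I"
proof -
  let ?F = "F_all M I g"
  have eq: "{\<omega>\<in>space ?F. band_maximizers v (g \<omega>) z = A} \<in> sets ?F" if "A \<subseteq> I" for A
  proof -
    let ?q = "\<lambda>\<omega> i. g \<omega> z i + band_value v (g \<omega>) (dyadic_above (height u z)) (z + i)"
    have [measurable]: "i \<in> I \<Longrightarrow> (\<lambda>\<omega>. ?q \<omega> i) \<in> borel_measurable ?F" for i
      by (intro borel_measurable_add g_measurable_F_all band_value_measurable)
    have "{\<omega>\<in>space ?F. band_maximizers v (g \<omega>) z = A}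
        = {\<omega>\<in>space ?F. \<forall>i\<in>I. i \<in> A \<longleftrightarrow> (\<forall>j\<in>I. ?q \<omega> j \<le> ?q \<omega> i)}"
      using that by (auto simp: band_maximizers_def)
    also have "\<dots> \<in> sets ?F"
      using I_finite by measurable
    finally show ?thesis .
  qed
  have "(\<lambda>\<omega>. band_action v (g \<omega>) z) -` {i} \<inter> space ?F \<in> sets ?F" for i
  proof -
    have "(\<lambda>\<omega>. band_action v (g \<omega>) z) -` {i} \<inter> space ?F
        = (\<Union>A\<in>{A\<in>Pow I. (SOME i. i \<in> A) = i}. {\<omega>\<in>space ?F. band_maximizers v (g \<omega>) z = A})"
      by (auto simp: band_action_def band_maximizers_def)
    also have "\<dots> \<in> sets ?F"
      using I_finite by (intro sets.finite_UN eq) auto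
    finally show ?thesis .
  qed
  then show ?thesis
    by (simp add: measurable_count_space_eq2 I_finite band_action_step)
qed

text \<open>The lattice is countable, so acting at a random state preserves measurability.\<close>

lemma visit_measurable: "(\<lambda>\<omega>. visit v \<omega> z j) \<in> F_all M I g \<rightarrow>\<^sub>M count_space UNIV"
proof (induction j)
  case (Suc j)
  have "(\<lambda>\<omega>. w + band_action v (g \<omega>) w) \<in> F_all M I g \<rightarrow>\<^sub>M count_space UNIV" for w
    by (rule measurable_compose[OF band_action_measurable]) simp
  from measurable_compose_countable[OF this Suc.IH] show ?case
    by (simp add: visit_Suc)
qed simp

lemma band_strategy_in_strategies: "band_strategy v \<in> strategies M I g"
  unfolding strategies_def
proof (intro CollectI allI impI)
  fix m :: nat
  have z: "(\<lambda>\<omega>. band_strategy v m \<omega> z) \<in> F_all M I g \<rightarrow>\<^sub>M count_space I" for z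
    unfolding band_strategy_def
    by (rule measurable_compose_countable[OF band_action_measurable visit_measurable])
  have "(\<lambda>p. band_strategy v m (fst p) (snd p))
      \<in> F_all M I g \<Otimes>\<^sub>M count_space UNIV \<rightarrow>\<^sub>M count_space I"
    by (rule measurable_compose_countable[OF measurable_compose[OF measurable_fst z] measurable_snd])
  then show "(\<lambda>(\<omega>, z). band_strategy v m \<omega> z) \<in> F_all M I g \<Otimes>\<^sub>M count_space UNIV \<rightarrow>\<^sub>M count_space I"
    by (simp add: case_prod_beta')
qed

section \<open>Long-run behaviour of the play\<close>

lemma visit_in_cube: "z \<in> cube r \<Longrightarrow> visit v \<omega> z j \<in> cube (r + int j * B)"
proof (induction j)
  case (Suc j)
  then have "visit v \<omega> z (Suc j) \<in> cube (r + int j * B + B)"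
    unfolding visit_Suc by (intro step_in_cube band_action_step) auto
  then show ?case by (simp add: algebra_simps)
qed simp

lemma height_visit_Suc: "height u (visit v \<omega> z j) < height u (visit v \<omega> z (Suc j))"
  using height_step[OF band_action_step, of v "g \<omega>" "visit v \<omega> z j"]
  by (simp add: visit_Suc height_add)

lemma height_visit_ge: "height u z + int j \<le> height u (visit v \<omega> z j)"
proof (induction j)
  case (Suc j)
  then show ?case using height_visit_Suc[of v \<omega> z j] by simp
qed simp

text \<open>At height \<open>x \<ge> 1\<close> the band ends by \<open>2 * x\<close>, so at most
  \<open>x\<close> steps remain in it, while \<open>j\<close> is at most \<open>x\<close> minus the
  initial height. For large \<open>x\<close> all states involved thus lie in a cube on which uniform
  closeness applies at scale \<open>2 * x\<close>.\<close>

lemma band_value_small: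
  fixes \<delta> :: real
  assumes "uniformly_close v \<omega>" "0 < \<delta>"
  shows "\<forall>\<^sub>F j in sequentially.
    \<bar>band_value v (g \<omega>) (dyadic_above (height u (visit v \<omega> z j))) (visit v \<omega> z j)\<bar>
      \<le> \<delta> * height u (visit v \<omega> z j)"
proof -
  have "\<forall>\<^sub>F n in sequentially. \<forall>m\<le>n. \<forall>z\<in>cube ((int n)\<^sup>2).
     \<bar>V (g \<omega>) m z - real m * v\<bar> \<le> \<delta> / 4 * real n"
    using assms(2) by (intro uniformly_closeD[OF assms(1)]) simp
  then obtain N where N: "\<And>n m z. N \<le> n \<Longrightarrow> m \<le> n \<Longrightarrow> z \<in> cube ((int n)\<^sup>2) \<Longrightarrow>
      \<bar>V (g \<omega>) m z - real m * v\<bar> \<le> \<delta> / 4 * real n"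
    unfolding eventually_sequentially by meson
  obtain r where r: "0 \<le> r" "z \<in> cube r"
    using cube_exhausts by blast
  \<comment> \<open>\<open>N\<close> serves uniform closeness, 1 the bound on
    \<open>dyadic_above\<close>, \<open>B\<close> the estimate \<open>x * B \<le> x * x\<close>, and
    the last term absorbs the initial position.\<close>
  define L where "L = max (int N) (max 1 (max B (r + \<bar>height u z\<bar> * B)))"
  show ?thesis
    using eventually_ge_at_top[of "nat (L - height u z)"]
  proof eventually_elim
    case (elim j)
    define w where "w = visit v \<omega> z j"
    define x where "x = height u w"
    define T where "T = dyadic_above x"
    \<comment> \<open>\<open>n^2 = 4 * x * x\<close> covers the reachable cube, and accuracy
      \<open>\<delta> / 4\<close> at scale \<open>2 * x\<close>, doubled by
      \<open>V_truncated_abs_le\<close>, gives exactly \<open>\<delta> * x\<close>.\<close>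
    define n where "n = nat (2 * x)"
    define k where "k = nat (T - x)"
    have jx: "int j \<le> x - height u z"
      using height_visit_ge[of z j v \<omega>] by (simp add: x_def w_def)
    have "L \<le> x"
      using elim jx by linarith
    then have x: "int N \<le> x" "1 \<le> x" "B \<le> x" "r + \<bar>height u z\<bar> * B \<le> x"
      by (auto simp: L_def)
    have n: "int n = 2 * x" "N \<le> n"
      using x by (auto simp: n_def)
    have k: "int k \<le> x"
      using dyadic_above_le[OF x(2)] x(2) less_dyadic_above[of x] by (simp add: k_def T_def)
    have w: "w \<in> cube (r + int j * B)"
      unfolding w_def by (rule visit_in_cube[OF r(2)])
    have "int j * B \<le> (x + \<bar>height u z\<bar>) * B"
      using jx B_nonneg by (intro mult_right_mono) auto
    moreover have "int k * B \<le> x * B" "x * B \<le> x * x" "x * 1 \<le> x * x"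
      using k x B_nonneg by (auto intro!: mult_right_mono mult_left_mono)
    ultimately have "r + int j * B + int k * B \<le> x + x * x + x * x"
      using x(4) by (simp add: distrib_right)
    also have "\<dots> \<le> 4 * (x * x)"
      using \<open>x * 1 \<le> x * x\<close> x(2) by (simp add: algebra_simps)
    also have "\<dots> = (int n)\<^sup>2"
      by (simp add: n power2_eq_square)
    finally have sub: "cube (r + int j * B + int k * B) \<subseteq> (cube ((int n)\<^sup>2) :: (int ^ 'd) set)"
      by (rule cube_mono)
    have "\<bar>V (truncated u T v (g \<omega>)) k w\<bar> \<le> 2 * (\<delta> / 4 * real n)"
    proof (rule V_truncated_abs_le[OF w])
      fix m and y :: "int ^ 'd" assume "m \<le> k" "y \<in> cube (r + int j * B + int k * B)"
      then show "\<bar>V (g \<omega>) m y - real m * v\<bar> \<le> \<delta> / 4 * real n"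
        using sub k n x by (intro N) auto
    qed
    also have "real n = 2 * x"
      using n(1) by (metis of_int_of_nat_eq of_int_mult of_int_numeral)
    finally show ?case
      by (simp add: band_value_def T_def k_def x_def w_def)
  qed
qed

text \<open>From above, the payoff is at most the optimal average, which tends to \<open>v\<close>.
  From below, the centred payoffs \<open>r\<close> satisfy the Bellman relation with the band
  potential \<open>p\<close>, so \<open>band_average_lower_bound\<close> applies.\<close>

lemma band_strategy_payoff:
  assumes close: "uniformly_close v \<omega>" and \<omega>: "\<omega> \<in> space M"
  shows "(\<lambda>n. payoff g n \<omega> z (band_strategy v)) \<longlonglongrightarrow> v"
proof (rule order_tendstoI)
  define s where "s = visit v \<omega> z"
  define r where "r j = g \<omega> (s j) (band_action v (g \<omega>) (s j)) - v" for j
  define p where "p j = band_value v (g \<omega>) (dyadic_above (height u (s j))) (s j)" for j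
  \<comment> \<open>An upper bound for the height gained in one step, hence the slope in the linear
    growth bound.\<close>
  define K :: real where "K = of_int ((\<Sum>k\<in>UNIV. \<bar>u $ k\<bar>) * B)"
  have payoff: "payoff g n \<omega> z (band_strategy v) = v + (\<Sum>j<n. r j) / real n" if "1 \<le> n" for n
    using that unfolding payoff_eq state_at_band_strategy r_def
    by (simp add: band_strategy_def s_def sum_subtractf diff_divide_distrib)
  have K: "real_of_int (height u (s j)) \<le> height u (s 0) + K * j" for j
  proof (induction j)
    case (Suc j)
    have "height u (band_action v (g \<omega>) (s j)) \<le> (\<Sum>k\<in>UNIV. \<bar>u $ k\<bar>) * B"
      using height_cube_le[of _ B u] band_action_step steps_in_cube by (meson abs_le_D1 subsetD)
    then have "real_of_int (height u (band_action v (g \<omega>) (s j))) \<le> K"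
      unfolding K_def by (rule of_int_le_iff[THEN iffD2])
    then show ?case
      using Suc by (simp add: s_def visit_Suc height_add distrib_left)
  qed simp
  have avg: "\<forall>\<^sub>F n in sequentially. (\<Sum>j<n. r j) \<ge> - \<epsilon> * n" if "0 < \<epsilon>" for \<epsilon> :: real
  proof (rule band_average_lower_bound[where x = "\<lambda>j. height u (s j)" and p = p and K = K])
    show "p j = r j + (if dyadic_above (height u (s (Suc j))) = dyadic_above (height u (s j)) then p (Suc j) else 0)" for j
      using band_value_action[of v "g \<omega>" "s j"] by (simp add: p_def r_def s_def visit_Suc)
  qed (use that height_visit_Suc band_value_small[OF close] K in \<open>auto simp: p_def s_def\<close>)
  show "\<forall>\<^sub>F n in sequentially. a < payoff g n \<omega> z (band_strategy v)" if "a < v" for a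
  proof -
    have "0 < (v - a) / 2" using that by simp
    from avg[OF this] eventually_ge_at_top[of 1] show ?thesis
    proof eventually_elim
      case (elim n)
      then have "- ((v - a) / 2) \<le> (\<Sum>j<n. r j) / real n"
        by (simp add: pos_le_divide_eq)
      then show ?case
        using payoff[OF elim(2)] that by (simp add: field_simps)
    qed
  qed
  show "\<forall>\<^sub>F n in sequentially. payoff g n \<omega> z (band_strategy v) < a" if "v < a" for a
    using order_tendstoD(2)[OF uniformly_close_limit[OF close, of z] that]
    by eventually_elim (rule le_less_trans[OF payoff_le[OF band_strategy_in_strategies \<omega>]])
qed

lemma stationary_optimal:
  "\<exists>\<sigma>\<in>strategies M I g. stationary M I \<sigma> \<and>
     (\<forall>z. AE \<omega> in M. (\<lambda>n. payoff g n \<omega> z \<sigma>) \<longlonglongrightarrow> limit_value M I g)"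
proof -
  obtain v where v: "AE \<omega> in M. uniformly_close v \<omega>"
    using AE_uniformly_close by blast
  have "AE \<omega> in M. (\<lambda>n. payoff g n \<omega> z (band_strategy v)) \<longlonglongrightarrow> v" for z
    using v AE_space by eventually_elim (rule band_strategy_payoff)
  then show ?thesis
    using stationary_band_strategy band_strategy_in_strategies limit_value_eq[OF v] by blast
qed

end

theorem theorem2p13:
  fixes M :: "'w measure" and I :: "(int ^ 'd) set"
    and g :: "'w \<Rightarrow> int ^ 'd \<Rightarrow> int ^ 'd \<Rightarrow> real"
  assumes "oriented_pmdp M I g"
  shows "\<exists>\<sigma>\<in>strategies M I g. stationary M I \<sigma> \<and>
           (\<forall>z. AE \<omega> in M. (\<lambda>n. payoff g n \<omega> z \<sigma>) \<longlonglongrightarrow> limit_value M I g)"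
proof -
  interpret oriented_pmdp M I g by fact
  obtain u where u: "\<And>i. i \<in> I \<Longrightarrow> 1 \<le> height u i"
    using integral_height_exists[OF I_finite oriented] by blast
  obtain B where B: "I \<subseteq> cube B"
    using finite_subset_cube[OF I_finite] by blast
  obtain C where C: "\<And>\<omega> z i. \<omega> \<in> space M \<Longrightarrow> i \<in> I \<Longrightarrow> \<bar>g \<omega> z i\<bar> \<le> C"
    using g_bounded by blast
  \<comment> \<open>The maximum with 1 makes the bound positive, as the given \<open>C\<close> may
    be 0.\<close>
  interpret graded_pmdp M I g u B "max 1 C"
    by unfold_locales (use I_finite I_nonempty u B C in \<open>auto intro: le_max_iff_disj[THEN iffD2]\<close>)
  show ?thesis by (rule stationary_optimal)
qed

end
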